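(* Let $\mathfrak g$ be an $n$-Lie algebra over $K$, $V$ a vector space, and $\rho:\mathcal L=\bigwedge^{n-1}\mathfrak g\to\mathrm{End}(V)$ a linear map. Then $\mathrm{Hom}(\mathfrak g,V)$, equipped with the maps $[\cdot,\cdot]_L:\mathcal L\otimes \mathrm{Hom}(\mathfrak g,V)\to \mathrm{Hom}(\mathfrak g,V)$ and $[\cdot,\cdot]_R:\mathrm{Hom}(\mathfrak g,V)\otimes\mathcal L\to \mathrm{Hom}(\mathfrak g,V)$ given by $$[(x_1,\dots,x_{n-1}),\phi]_L(x_n)=\rho(x_1,\dots,x_{n-1})\phi(x_n)-\phi([x_1,\dots,x_{n-1},x_n]),$$ $$[\phi,(x_1,\dots,x_{n-1})]_R(x_n)=\phi([x_1,\dots,x_n])-\sum_{i=1}^n(-1)^{n-i}\rho(x_1,\dots,\widehat{x_i},\dots,x_n)\phi(x_i),$$ is a representation of the Leibniz algebra $\mathcal L$ if and only if the following two conditions hold for all $x_i,y_i\in\mathfrak g$: (R1) $[\rho(x_1,\dots,x_{n-1}),\rho(y_1,\dots,y_{n-1})]=\rho((x_1,\dots,x_{n-1})\circ(y_1,\dots,y_{n-1}))$, where the left side is the commutator in $\mathrm{End}(V)$; (R2) $\rho(x_1,\dots,x_{n-2},[y_1,\dots,y_n])=\sum_{i=1}^n(-1)^{n-i}\rho(y_1,\dots,\widehat{y_i},\dots,y_n)\,\rho(x_1,\dots,x_{n-2},y_i)$.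
   Context: $K$ is a field of characteristic zero; all vector spaces are over $K$ and all maps are $K$-linear; $n\ge 2$. A hat denotes omission. An $n$-Lie algebra is a vector space $\mathfrak g$ with an alternating $n$-linear map $[-,\dots,-]:\bigwedge^n\mathfrak g\to\mathfrak g$ satisfying the Filippov identity $[x_1,\dots,x_{n-1},[y_1,\dots,y_n]]=\sum_{i=1}^n[y_1,\dots,y_{i-1},[x_1,\dots,x_{n-1},y_i],y_{i+1},\dots,y_n]$. On $\mathcal L=\bigwedge^{n-1}\mathfrak g$, writing $X=(x_1,\dots,x_{n-1})$ for $x_1\wedge\dots\wedge x_{n-1}$ and similarly $Y=(y_1,\dots,y_{n-1})$, define $X\circ Y=\sum_{i=1}^{n-1}(y_1,\dots,[x_1,\dots,x_{n-1},y_i],\dots,y_{n-1})$, extended bilinearly. It is known that $\mathcal L$ is a (left) Leibniz algebra: $X\circ(Y\circ Z)=(X\circ Y)\circ Z+Y\circ(X\circ Z)$. A representation of a Leibniz algebra $\mathcal L$ is a vector space $M$ with bilinear maps $[\cdot,\cdot]_L:\mathcal L\times M\to M$ and $[\cdot,\cdot]_R:M\times\mathcal L\to M$ such that for all $X,Y\in\mathcal L$, $m\in M$: (LLM) $[X\circ Y,m]_L=[X,[Y,m]_L]_L-[Y,[X,m]_L]_L$; (LML) $[m,X\circ Y]_R=[[m,X]_R,Y]_R+[X,[m,Y]_R]_L$; (MLL) $[m,X\circ Y]_R=[X,[m,Y]_R]_L-[[X,m]_L,Y]_R$. *)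

theory Defs
  imports
    "HOL-Library.Poly_Mapping"
    "HOL-Library.Set_Algebras"
    "HOL-Algebra.Algebraic_Closure_Type"
begin

section \<open>Vector spaces with an explicit carrier\<close>

text \<open>
  The spaces \<open>\<gg>\<close> and \<open>V\<close> are whole types, with a scalar multiplication satisfying
  \<^locale>\<open>vector_space\<close>. The spaces built from them (exterior powers, \<open>Hom\<close> and \<open>End\<close>) depend
  on these scalar multiplications, so they are given as \<open>HOL-Algebra\<close> modules over the field
  \<open>'k\<close>. The ring multiplication and unit fields of a module record play no role and are
  left \<open>undefined\<close>.
\<close>

abbreviation K_ring :: "'k::field ring"
  where "K_ring \<equiv> ring_of_type_algebra"

definition hom_space ::
  "('k::field \<Rightarrow> 'a::ab_group_add \<Rightarrow> 'a) \<Rightarrow> ('k \<Rightarrow> 'b::ab_group_add \<Rightarrow> 'b) \<Rightarrow> ('k, 'a \<Rightarrow> 'b) module"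
  where "hom_space s1 s2 =
    \<lparr> carrier = {\<phi>. Vector_Spaces.linear s1 s2 \<phi>},
      monoid.mult = undefined, one = undefined,
      ring.zero = (\<lambda>x. 0), add = (\<lambda>\<phi> \<psi> x. \<phi> x + \<psi> x),
      module.smult = (\<lambda>c \<phi> x. s2 c (\<phi> x)) \<rparr>"

lemma module_hom_space:
  assumes "vector_space s1" "vector_space s2"
  shows "Module.module K_ring (hom_space s1 s2)"
proof -
  interpret V1: vector_space s1 by fact
  interpret V2: vector_space s2 by fact
  interpret P: vector_space_pair s1 s2 ..
  show ?thesis
  proof (rule moduleI)
    show "cring K_ring" by (rule cring_from_type_algebra)
    show "abelian_group (hom_space s1 s2)"
    proof (rule abelian_groupI)
      fix \<phi> assume "\<phi> \<in> carrier (hom_space s1 s2)"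
      then show "\<exists>y\<in>carrier (hom_space s1 s2). y \<oplus>\<^bsub>hom_space s1 s2\<^esub> \<phi> = \<zero>\<^bsub>hom_space s1 s2\<^esub>"
        by (intro bexI[where x = "\<lambda>x. - \<phi> x"]) (auto simp: hom_space_def P.linear_compose_neg)
    qed (auto simp: hom_space_def P.linear_compose_add P.linear_zero add_ac)
  qed (auto simp: hom_space_def ring_of_type_algebra_def P.linear_compose_scale_right
        V2.scale_right_distrib V2.scale_left_distrib)
qed

definition carrier_linear ::
  "('k, 'a) module \<Rightarrow> ('k, 'b) module \<Rightarrow> ('a \<Rightarrow> 'b) \<Rightarrow> bool"
  where "carrier_linear M N f \<longleftrightarrow>
    f \<in> carrier M \<rightarrow> carrier N \<and>
    (\<forall>x\<in>carrier M. \<forall>y\<in>carrier M. f (x \<oplus>\<^bsub>M\<^esub> y) = f x \<oplus>\<^bsub>N\<^esub> f y) \<and>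
    (\<forall>c. \<forall>x\<in>carrier M. f (c \<odot>\<^bsub>M\<^esub> x) = c \<odot>\<^bsub>N\<^esub> f x)"

definition carrier_bilinear ::
  "('k, 'a) module \<Rightarrow> ('k, 'b) module \<Rightarrow> ('k, 'c) module \<Rightarrow> ('a \<Rightarrow> 'b \<Rightarrow> 'c) \<Rightarrow> bool"
  where "carrier_bilinear L M N f \<longleftrightarrow>
    (\<forall>x\<in>carrier L. carrier_linear M N (f x)) \<and>
    (\<forall>y\<in>carrier M. carrier_linear L N (\<lambda>x. f x y))"


section \<open>Exterior powers\<close>

text \<open>
  The \<open>k\<close>-th exterior power is the vector space generated by symbols \<open>x\<^sub>1 \<and> \<dots> \<and> x\<^sub>k\<close> subject to
  multilinearity and to the vanishing of symbols with a repeated entry: the quotient of the free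
  vector space on lists of length \<open>k\<close> by the span of the relators. Its elements are cosets.
\<close>

definition free_scale :: "'k::field \<Rightarrow> ('a \<Rightarrow>\<^sub>0 'k) \<Rightarrow> ('a \<Rightarrow>\<^sub>0 'k)"
  where "free_scale c = Poly_Mapping.map ((*) c)"

lemma lookup_free_scale [simp]:
  "Poly_Mapping.lookup (free_scale c a) x = c * Poly_Mapping.lookup a x"
  by (simp add: free_scale_def Poly_Mapping.map.rep_eq when_def)

global_interpretation free: vector_space free_scale
  by unfold_locales (auto intro!: poly_mapping_eqI simp: lookup_add algebra_simps)

definition free_lists :: "nat \<Rightarrow> ('a list \<Rightarrow>\<^sub>0 'k::field) set"
  where "free_lists k = {a. Poly_Mapping.keys a \<subseteq> {xs. length xs = k}}"

definition ext_relators ::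
  "('k::field \<Rightarrow> 'a::ab_group_add \<Rightarrow> 'a) \<Rightarrow> nat \<Rightarrow> ('a list \<Rightarrow>\<^sub>0 'k) set"
  where "ext_relators s k =
    {Poly_Mapping.single (xs[i := x + y]) 1
       - Poly_Mapping.single (xs[i := x]) 1 - Poly_Mapping.single (xs[i := y]) 1
      | xs i x y. length xs = k \<and> i < k} \<union>
    {Poly_Mapping.single (xs[i := s c x]) 1 - Poly_Mapping.single (xs[i := x]) c
      | xs i c x. length xs = k \<and> i < k} \<union>
    {Poly_Mapping.single xs 1
      | xs i j. length xs = k \<and> i < j \<and> j < k \<and> xs ! i = xs ! j}"

definition ext_class ::
  "('k::field \<Rightarrow> 'a::ab_group_add \<Rightarrow> 'a) \<Rightarrow> nat \<Rightarrow> ('a list \<Rightarrow>\<^sub>0 'k) \<Rightarrow> ('a list \<Rightarrow>\<^sub>0 'k) set"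
  where "ext_class s k a = a +o free.span (ext_relators s k)"

text \<open>In \<open>smult\<close>, the relator span is added so that \<open>0\<close> times a coset is again a coset.\<close>

definition ext_power ::
  "('k::field \<Rightarrow> 'a::ab_group_add \<Rightarrow> 'a) \<Rightarrow> nat \<Rightarrow> ('k, ('a list \<Rightarrow>\<^sub>0 'k) set) module"
  where "ext_power s k =
    \<lparr> carrier = ext_class s k ` free_lists k,
      monoid.mult = undefined, one = undefined,
      ring.zero = free.span (ext_relators s k), add = (\<lambda>A B. A + B),
      module.smult = (\<lambda>c A. free_scale c ` A + free.span (ext_relators s k)) \<rparr>"

lemma ext_class_plus: "ext_class s k a + ext_class s k b = ext_class s k (a + b)"
proof -
  let ?R = "free.span (ext_relators s k)"
  have "?R + ?R = ?R"
    by (auto simp: set_plus_def free.span_add) (metis add.right_neutral free.span_zero)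
  then show ?thesis
    by (simp add: ext_class_def set_plus_rearrange)
qed

lemma ext_class_scale:
  "free_scale c ` ext_class s k a + free.span (ext_relators s k) = ext_class s k (free_scale c a)"
  (is "?L = ?R")
proof
  show "?L \<subseteq> ?R"
    by (auto simp: ext_class_def elt_set_plus_def set_plus_def free.scale_right_distrib add.assoc
        intro!: free.span_add free.span_scale)
  show "?R \<subseteq> ?L"
  proof
    fix y assume "y \<in> ?R"
    then obtain r where r: "r \<in> free.span (ext_relators s k)" "y = free_scale c a + r"
      by (auto simp: ext_class_def elt_set_plus_def)
    moreover have "a \<in> ext_class s k a"
      using free.span_zero[of "ext_relators s k"] by (force simp: ext_class_def elt_set_plus_def)
    ultimately show "y \<in> ?L" by auto
  qed
qed

lemma ext_class_zero: "ext_class s k 0 = free.span (ext_relators s k)"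
  by (simp add: ext_class_def elt_set_plus_def)

lemma subspace_free_lists: "free.subspace (free_lists k :: ('a list \<Rightarrow>\<^sub>0 'k::field) set)"
proof (rule free.subspaceI)
  show "x + y \<in> free_lists k" if "x \<in> free_lists k" "y \<in> free_lists k"
    for x y :: "'a list \<Rightarrow>\<^sub>0 'k"
    using that keys_add[of x y] by (auto simp: free_lists_def)
qed (auto simp: free_lists_def in_keys_iff)

lemma ext_power_simps:
  "carrier (ext_power s k) = ext_class s k ` free_lists k"
  "\<zero>\<^bsub>ext_power s k\<^esub> = ext_class s k 0"
  "ext_class s k a \<oplus>\<^bsub>ext_power s k\<^esub> ext_class s k b = ext_class s k (a + b)"
  "c \<odot>\<^bsub>ext_power s k\<^esub> ext_class s k a = ext_class s k (free_scale c a)"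
  by (simp_all add: ext_power_def ext_class_zero ext_class_plus ext_class_scale)

lemma module_ext_power: "Module.module K_ring (ext_power s k)"
proof (rule moduleI)
  show "cring K_ring" by (rule cring_from_type_algebra)
  show "abelian_group (ext_power s k)"
  proof (rule abelian_groupI)
    fix A assume "A \<in> carrier (ext_power s k)"
    then obtain a where a: "a \<in> free_lists k" "A = ext_class s k a" by (auto simp: ext_power_simps)
    then have "ext_class s k (- a) \<in> carrier (ext_power s k)"
      by (auto simp: ext_power_simps intro: free.subspace_neg[OF subspace_free_lists])
    then show "\<exists>y\<in>carrier (ext_power s k). y \<oplus>\<^bsub>ext_power s k\<^esub> A = \<zero>\<^bsub>ext_power s k\<^esub>"
      by (rule rev_bexI) (simp add: a ext_power_simps)
  qed (auto simp: ext_power_simps add_ac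
       intro!: imageI free.subspace_add free.subspace_0 subspace_free_lists)
qed (auto simp: ext_power_simps ring_of_type_algebra_def
       free.scale_right_distrib free.scale_left_distrib
     intro!: imageI free.subspace_scale subspace_free_lists)

definition wedge ::
  "('k::field \<Rightarrow> 'a::ab_group_add \<Rightarrow> 'a) \<Rightarrow> 'a list \<Rightarrow> ('a list \<Rightarrow>\<^sub>0 'k) set"
  where "wedge s xs = ext_class s (length xs) (Poly_Mapping.single xs 1)"

text \<open>
  The linear extension to an exterior power of a map given on the elements \<open>x\<^sub>1 \<and> \<dots> \<and> x\<^sub>k\<close>,
  computed on a chosen representative. It is independent of that choice when the map is
  multilinear and alternating; see \<open>extend_wedge\<close> and \<open>extend_linear\<close> below.
\<close>

definition extend ::
  "('k::field, 'b) module \<Rightarrow> ('a list \<Rightarrow> 'b) \<Rightarrow> ('a list \<Rightarrow>\<^sub>0 'k) set \<Rightarrow> 'b"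
  where "extend M f A =
    (let a = (SOME a. a \<in> A)
     in \<Oplus>\<^bsub>M\<^esub>xs\<in>Poly_Mapping.keys a. Poly_Mapping.lookup a xs \<odot>\<^bsub>M\<^esub> f xs)"

context
  fixes s :: "'k::field \<Rightarrow> 'a::ab_group_add \<Rightarrow> 'a" and k :: nat
    and M :: "('k, 'b) module" and f :: "'a list \<Rightarrow> 'b"
  assumes module_M: "Module.module (K_ring :: 'k ring) M"
    and closed: "\<And>xs. length xs = k \<Longrightarrow> f xs \<in> carrier M"
    and additive: "\<And>xs i x y. length xs = k \<Longrightarrow> i < k \<Longrightarrow>
      f (xs[i := x + y]) = f (xs[i := x]) \<oplus>\<^bsub>M\<^esub> f (xs[i := y])"
    and homogeneous: "\<And>xs i c x. length xs = k \<Longrightarrow> i < k \<Longrightarrow>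
      f (xs[i := s c x]) = c \<odot>\<^bsub>M\<^esub> f (xs[i := x])"
    and alternating: "\<And>xs i j. length xs = k \<Longrightarrow> i < j \<Longrightarrow> j < k \<Longrightarrow> xs ! i = xs ! j \<Longrightarrow>
      f xs = \<zero>\<^bsub>M\<^esub>"
begin

interpretation M: Module.module "K_ring :: 'k ring" M by (fact module_M)

private definition E :: "('a list \<Rightarrow>\<^sub>0 'k) \<Rightarrow> 'b"
  where "E a = (\<Oplus>\<^bsub>M\<^esub>xs\<in>Poly_Mapping.keys a. Poly_Mapping.lookup a xs \<odot>\<^bsub>M\<^esub> f xs)"

private lemma sclosed [simp]: "x \<in> carrier M \<Longrightarrow> c \<odot>\<^bsub>M\<^esub> x \<in> carrier M"
  using M.smult_closed by (simp add: ring_of_type_algebra_def)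

private lemma zero_smult [simp]: "x \<in> carrier M \<Longrightarrow> 0 \<odot>\<^bsub>M\<^esub> x = \<zero>\<^bsub>M\<^esub>"
  using M.smult_l_null by (simp add: ring_of_type_algebra_def)

private lemma one_smult [simp]: "x \<in> carrier M \<Longrightarrow> 1 \<odot>\<^bsub>M\<^esub> x = x"
  using M.smult_one by (simp add: ring_of_type_algebra_def)

private lemma E_superset:
  assumes "a \<in> free_lists k" "finite T" "Poly_Mapping.keys a \<subseteq> T" "T \<subseteq> {xs. length xs = k}"
  shows "E a = (\<Oplus>\<^bsub>M\<^esub>xs\<in>T. Poly_Mapping.lookup a xs \<odot>\<^bsub>M\<^esub> f xs)"
  unfolding E_def using assms closed
  by (intro M.add.finprod_mono_neutral_cong_left) (auto simp: in_keys_iff)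

private lemma E_closed: "a \<in> free_lists k \<Longrightarrow> E a \<in> carrier M"
  unfolding E_def using closed by (intro M.finsum_closed) (auto simp: free_lists_def)

private lemma E_add:
  assumes "a \<in> free_lists k" "b \<in> free_lists k"
  shows "E (a + b) = E a \<oplus>\<^bsub>M\<^esub> E b"
proof -
  let ?T = "Poly_Mapping.keys a \<union> Poly_Mapping.keys b"
  have T: "finite ?T" "?T \<subseteq> {xs. length xs = k}" using assms by (auto simp: free_lists_def)
  have ab: "a + b \<in> free_lists k" using assms free.subspace_add[OF subspace_free_lists] by blast
  have "E (a + b) = (\<Oplus>\<^bsub>M\<^esub>xs\<in>?T. Poly_Mapping.lookup (a + b) xs \<odot>\<^bsub>M\<^esub> f xs)"
    using ab T keys_add[of a b] by (intro E_superset) auto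
  also have "\<dots> = (\<Oplus>\<^bsub>M\<^esub>xs\<in>?T. Poly_Mapping.lookup a xs \<odot>\<^bsub>M\<^esub> f xs \<oplus>\<^bsub>M\<^esub> Poly_Mapping.lookup b xs \<odot>\<^bsub>M\<^esub> f xs)"
    using T closed M.smult_l_distr
    by (intro M.add.finprod_cong') (auto simp: lookup_add ring_of_type_algebra_def)
  also have "\<dots> = (\<Oplus>\<^bsub>M\<^esub>xs\<in>?T. Poly_Mapping.lookup a xs \<odot>\<^bsub>M\<^esub> f xs) \<oplus>\<^bsub>M\<^esub>
      (\<Oplus>\<^bsub>M\<^esub>xs\<in>?T. Poly_Mapping.lookup b xs \<odot>\<^bsub>M\<^esub> f xs)"
    using T closed by (intro M.finsum_addf) auto
  also have "\<dots> = E a \<oplus>\<^bsub>M\<^esub> E b"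
    using assms T by (simp add: E_superset[of _ ?T])
  finally show ?thesis .
qed

private lemma E_scale:
  assumes "a \<in> free_lists k"
  shows "E (free_scale c a) = c \<odot>\<^bsub>M\<^esub> E a"
proof -
  let ?T = "Poly_Mapping.keys a"
  have T: "finite ?T" "?T \<subseteq> {xs. length xs = k}" using assms by (auto simp: free_lists_def)
  have ca: "free_scale c a \<in> free_lists k"
    using assms free.subspace_scale[OF subspace_free_lists] by blast
  have "E (free_scale c a) = (\<Oplus>\<^bsub>M\<^esub>xs\<in>?T. Poly_Mapping.lookup (free_scale c a) xs \<odot>\<^bsub>M\<^esub> f xs)"
    using ca T by (intro E_superset) (auto simp: in_keys_iff)
  also have "\<dots> = (\<Oplus>\<^bsub>M\<^esub>xs\<in>?T. c \<odot>\<^bsub>M\<^esub> (Poly_Mapping.lookup a xs \<odot>\<^bsub>M\<^esub> f xs))"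
    using T closed M.smult_assoc1
    by (intro M.add.finprod_cong') (auto simp: ring_of_type_algebra_def)
  also have "\<dots> = c \<odot>\<^bsub>M\<^esub> E a"
    unfolding E_def using T closed
    by (intro M.finsum_smult_ldistr[symmetric]) (auto simp: ring_of_type_algebra_def)
  finally show ?thesis .
qed

private lemma single_free_lists: "length xs = k \<Longrightarrow> Poly_Mapping.single xs c \<in> free_lists k"
  by (auto simp: free_lists_def)

private lemma E_single: "length xs = k \<Longrightarrow> E (Poly_Mapping.single xs c) = c \<odot>\<^bsub>M\<^esub> f xs"
  using E_superset[of "Poly_Mapping.single xs c" "{xs}"] closed[of xs]
  by (simp add: single_free_lists)

private lemma E_diff:
  assumes "a \<in> free_lists k" "b \<in> free_lists k"
  shows "E (a - b) = E a \<ominus>\<^bsub>M\<^esub> E b"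
proof -
  have "a - b \<in> free_lists k" using assms free.subspace_diff[OF subspace_free_lists] by blast
  then have "E a = E (a - b) \<oplus>\<^bsub>M\<^esub> E b" using E_add[of "a - b" b] assms by simp
  then show ?thesis
    using \<open>a - b \<in> _\<close> assms E_closed by (simp add: M.minus_eq M.a_assoc M.r_neg)
qed

private lemma E_relator:
  assumes "r \<in> free.span (ext_relators s k)"
  shows "r \<in> free_lists k \<and> E r = \<zero>\<^bsub>M\<^esub>"
  using assms
proof (induction rule: free.span_induct)
  case base
  show ?case
  proof (rule free.subspaceI)
    show "0 \<in> {x. x \<in> free_lists k \<and> E x = \<zero>\<^bsub>M\<^esub>}"
      by (simp add: E_def free_lists_def)
  qed (auto simp: E_add E_scale ring_of_type_algebra_def
         intro: free.subspace_add[OF subspace_free_lists] free.subspace_scale[OF subspace_free_lists]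
           M.smult_r_null[unfolded ring_of_type_algebra_def, simplified])
next
  case (step r)
  note D = free.subspace_diff[OF subspace_free_lists]
  consider (add) xs i x y where "length xs = k" "i < k"
      "r = Poly_Mapping.single (xs[i := x + y]) 1
       - Poly_Mapping.single (xs[i := x]) 1 - Poly_Mapping.single (xs[i := y]) 1"
    | (scale) xs i c x where "length xs = k" "i < k"
      "r = Poly_Mapping.single (xs[i := s c x]) 1 - Poly_Mapping.single (xs[i := x]) c"
    | (alt) xs i j where "length xs = k" "i < j" "j < k" "xs ! i = xs ! j"
      "r = Poly_Mapping.single xs 1"
    using step by (auto simp: ext_relators_def)
  then show ?case
  proof cases
    case add
    let ?p = "f (xs[i := x])" and ?q = "f (xs[i := y])"
    have c: "?p \<in> carrier M" "?q \<in> carrier M" using add closed by auto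
    have "(?p \<oplus>\<^bsub>M\<^esub> ?q) \<ominus>\<^bsub>M\<^esub> ?p \<ominus>\<^bsub>M\<^esub> ?q = \<zero>\<^bsub>M\<^esub>"
      using c by (metis M.a_comm M.add.inv_closed M.add.inv_solve_right M.minus_eq M.r_neg M.a_closed)
    then show ?thesis
      using add c by (simp add: E_diff E_single single_free_lists D additive)
  next
    case scale
    then show ?thesis using closed
      by (simp add: E_diff E_single single_free_lists D homogeneous M.minus_eq M.r_neg)
  next
    case alt
    then show ?thesis using closed
      by (simp add: E_single single_free_lists alternating[OF alt(1-4)])
  qed
qed

private lemma extend_ext_class:
  assumes "a \<in> free_lists k"
  shows "extend M f (ext_class s k a) = E a"
proof -
  define b where "b = (SOME b. b \<in> ext_class s k a)"
  have "a \<in> ext_class s k a"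
    using free.span_zero[of "ext_relators s k"] by (force simp: ext_class_def elt_set_plus_def)
  then have "b \<in> ext_class s k a" unfolding b_def by (rule someI)
  then obtain r where "r \<in> free.span (ext_relators s k)" "b = a + r"
    by (auto simp: ext_class_def elt_set_plus_def)
  then have "E b = E a" using E_relator[of r] E_add[of a r] assms E_closed by simp
  then show ?thesis by (simp add: extend_def E_def b_def)
qed

lemma extend_wedge: "length xs = k \<Longrightarrow> extend M f (wedge s xs) = f xs"
  using extend_ext_class[of "Poly_Mapping.single xs 1"] closed[of xs]
  by (simp add: wedge_def single_free_lists E_single)

lemma extend_linear: "carrier_linear (ext_power s k) M (extend M f)"
  unfolding carrier_linear_def
  by (auto simp: ext_power_simps extend_ext_class E_closed E_add E_scale
      free.subspace_add[OF subspace_free_lists] free.subspace_scale[OF subspace_free_lists])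

end


section \<open>\<open>n\<close>-Lie algebras\<close>

definition alternating_multilinear ::
  "nat \<Rightarrow> ('k::field \<Rightarrow> 'a::ab_group_add \<Rightarrow> 'a) \<Rightarrow> ('k \<Rightarrow> 'b::ab_group_add \<Rightarrow> 'b)
    \<Rightarrow> ('a list \<Rightarrow> 'b) \<Rightarrow> bool"
  where "alternating_multilinear k s1 s2 f \<longleftrightarrow>
    (\<forall>xs i. length xs = k \<longrightarrow> i < k \<longrightarrow> Vector_Spaces.linear s1 s2 (\<lambda>x. f (xs[i := x]))) \<and>
    (\<forall>xs i j. length xs = k \<longrightarrow> i < j \<longrightarrow> j < k \<longrightarrow> xs ! i = xs ! j \<longrightarrow> f xs = 0)"

locale n_Lie_algebra = vector_space scale
  for scale :: "'k::field_char_0 \<Rightarrow> 'g::ab_group_add \<Rightarrow> 'g" +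
  fixes n :: nat
    and br :: "'g list \<Rightarrow> 'g"
  assumes n_ge_2: "n \<ge> 2"
    and br_alternating: "alternating_multilinear n scale scale br"
    and Filippov: "\<And>xs ys. length xs = n - 1 \<Longrightarrow> length ys = n \<Longrightarrow>
      br (xs @ [br ys]) = (\<Sum>i<n. br (ys[i := br (xs @ [ys ! i])]))"

definition circ ::
  "('k::field \<Rightarrow> 'g::ab_group_add \<Rightarrow> 'g) \<Rightarrow> nat \<Rightarrow> ('g list \<Rightarrow> 'g)
    \<Rightarrow> ('g list \<Rightarrow>\<^sub>0 'k) set \<Rightarrow> ('g list \<Rightarrow>\<^sub>0 'k) set \<Rightarrow> ('g list \<Rightarrow>\<^sub>0 'k) set"
  where "circ s n br A B =
    (let L = ext_power s (n - 1) in
     extend L (\<lambda>xs.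
       extend L (\<lambda>ys. \<Oplus>\<^bsub>L\<^esub>i\<in>{..<n - 1}. wedge s (ys[i := br (xs @ [ys ! i])])) B) A)"


section \<open>Leibniz algebras and their representations\<close>

locale leibniz_algebra = L: Module.module "K_ring :: 'k ring" L
  for L :: "('k::field, 'l) module" +
  fixes mul :: "'l \<Rightarrow> 'l \<Rightarrow> 'l"
  assumes mul_bilinear: "carrier_bilinear L L L mul"
    and leibniz: "\<lbrakk> A \<in> carrier L; B \<in> carrier L; C \<in> carrier L \<rbrakk> \<Longrightarrow>
      mul A (mul B C) = mul (mul A B) C \<oplus>\<^bsub>L\<^esub> mul B (mul A C)"

locale leibniz_representation =
  leibniz_algebra L mul + M: Module.module "K_ring :: 'k ring" M
  for L :: "('k::field, 'l) module" and mul :: "'l \<Rightarrow> 'l \<Rightarrow> 'l" and M :: "('k, 'm) module" +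
  fixes lact :: "'l \<Rightarrow> 'm \<Rightarrow> 'm"
    and ract :: "'m \<Rightarrow> 'l \<Rightarrow> 'm"
  assumes lact_bilinear: "carrier_bilinear L M M lact"
    and ract_bilinear: "carrier_bilinear M L M ract"
    and LLM: "\<lbrakk> A \<in> carrier L; B \<in> carrier L; m \<in> carrier M \<rbrakk> \<Longrightarrow>
      lact (mul A B) m = lact A (lact B m) \<ominus>\<^bsub>M\<^esub> lact B (lact A m)"
    and LML: "\<lbrakk> A \<in> carrier L; B \<in> carrier L; m \<in> carrier M \<rbrakk> \<Longrightarrow>
      ract m (mul A B) = ract (ract m A) B \<oplus>\<^bsub>M\<^esub> lact A (ract m B)"
    and MLL: "\<lbrakk> A \<in> carrier L; B \<in> carrier L; m \<in> carrier M \<rbrakk> \<Longrightarrow>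
      ract m (mul A B) = lact A (ract m B) \<ominus>\<^bsub>M\<^esub> ract (lact A m) B"


section \<open>The two actions on \<open>Hom(\<gg>, V)\<close>\<close>

definition omit :: "nat \<Rightarrow> 'a list \<Rightarrow> 'a list"
  where "omit i xs = take i xs @ drop (Suc i) xs"

definition hom_lact ::
  "('k::field \<Rightarrow> 'g::ab_group_add \<Rightarrow> 'g) \<Rightarrow> ('g list \<Rightarrow> 'g)
    \<Rightarrow> ('k \<Rightarrow> 'v::ab_group_add \<Rightarrow> 'v) \<Rightarrow> (('g list \<Rightarrow>\<^sub>0 'k) set \<Rightarrow> 'v \<Rightarrow> 'v)
    \<Rightarrow> ('g list \<Rightarrow>\<^sub>0 'k) set \<Rightarrow> ('g \<Rightarrow> 'v) \<Rightarrow> ('g \<Rightarrow> 'v)"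
  where "hom_lact sg br sv \<rho> A \<phi> =
    extend (hom_space sg sv) (\<lambda>xs x. \<rho> (wedge sg xs) (\<phi> x) - \<phi> (br (xs @ [x]))) A"

text \<open>
  List positions start at \<open>0\<close>, so the sign \<open>(-1)\<^sup>n\<^sup>-\<^sup>i\<close> of the entry \<open>x\<^sub>i\<close> is \<open>(-1) ^ (n - 1 - i)\<close>
  for the entry at position \<open>i\<close>.
\<close>

definition hom_ract ::
  "('k::field \<Rightarrow> 'g::ab_group_add \<Rightarrow> 'g) \<Rightarrow> nat \<Rightarrow> ('g list \<Rightarrow> 'g)
    \<Rightarrow> ('k \<Rightarrow> 'v::ab_group_add \<Rightarrow> 'v) \<Rightarrow> (('g list \<Rightarrow>\<^sub>0 'k) set \<Rightarrow> 'v \<Rightarrow> 'v)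
    \<Rightarrow> ('g \<Rightarrow> 'v) \<Rightarrow> ('g list \<Rightarrow>\<^sub>0 'k) set \<Rightarrow> ('g \<Rightarrow> 'v)"
  where "hom_ract sg n br sv \<rho> \<phi> A =
    extend (hom_space sg sv) (\<lambda>xs x.
      let zs = xs @ [x] in
      \<phi> (br zs) -
      (\<Sum>i<n. sv ((-1) ^ (n - 1 - i)) (\<rho> (wedge sg (omit i zs)) (\<phi> (zs ! i))))) A"

end

theory Submission
  imports Defs
begin

text \<open>
  For a linear map \<open>\<phi> : \<gg> \<rightarrow> V\<close> put
  \<open>d\<phi>(z\<^sub>1, \<dots>, z\<^sub>n) = \<phi>[z\<^sub>1, \<dots>, z\<^sub>n] - \<Sum>\<^sub>i (-1)\<^sup>n\<^sup>-\<^sup>i \<rho>(z\<^sub>1, \<dots>, omit z\<^sub>i, \<dots>, z\<^sub>n) \<phi>(z\<^sub>i)\<close>, which is called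
  \<open>coboundary \<phi>\<close> below. It is alternating in all \<open>n\<close> entries, and \<open>[\<phi>, Y]\<^sub>R(z) = d\<phi>(Y, z)\<close>. All axioms
  of a representation are linear in both elements of \<open>\<L>\<close>, so that they can be studied for wedges
  \<open>X = x\<^sub>1 \<and> \<dots> \<and> x\<^sub>n\<^sub>-\<^sub>1\<close> and \<open>Y\<close>.

  \<^item> The two sides of (LLM), evaluated at \<open>z\<close>, differ by \<open>\<rho>(X \<circ> Y) \<phi>(z) - [\<rho>(X), \<rho>(Y)] \<phi>(z)\<close>; see
    \<open>LLM_defect\<close>. So (R1) implies (LLM), and the converse holds because every vector of \<open>V\<close> is of the form
    \<open>\<phi>(z)\<close> when \<open>\<gg> \<noteq> 0\<close>, while \<open>\<L> = 0\<close> when \<open>\<gg> = 0\<close>.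
  \<^item> By (R1) and the Filippov identity, \<open>d\<close> commutes with the action of \<open>X\<close>; see
    \<open>coboundary_lact_fun\<close>. Separating the last of the \<open>n\<close> entries turns this into (MLL).
  \<^item> In the presence of (MLL), the axiom (LML) says that \<open>[[\<phi>, X]\<^sub>R + [X, \<phi>]\<^sub>L, Y]\<^sub>R = 0\<close>. Here the inner map is
    \<open>z \<mapsto> - \<Sum>\<^sub>i\<^sub><\<^sub>n (-1)\<^sup>n\<^sup>-\<^sup>i \<rho>(x\<^sub>1, \<dots>, omit x\<^sub>i, \<dots>, x\<^sub>n\<^sub>-\<^sub>1, z) \<phi>(x\<^sub>i)\<close>, and the value of the outer action at \<open>z\<close>
    is minus the sum, over \<open>i < n\<close> and with the same signs, of the defects of (R2) for the lists
    \<open>x\<^sub>1, \<dots>, omit x\<^sub>i, \<dots>, x\<^sub>n\<^sub>-\<^sub>1\<close> and \<open>Y, z\<close>, applied to \<open>\<phi>(x\<^sub>i)\<close>; see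
    \<open>ract_fun_ract_fun_plus_lact_fun\<close>. So (R2) implies (LML). Conversely, given
    \<open>x\<^sub>1, \<dots>, x\<^sub>n\<^sub>-\<^sub>2\<close>, take \<open>x\<^sub>n\<^sub>-\<^sub>1\<close> outside their span and \<open>\<phi>\<close> vanishing on this span with \<open>\<phi>(x\<^sub>n\<^sub>-\<^sub>1)\<close>
    arbitrary: a single defect remains and must be \<open>0\<close>. If the \<open>x\<^sub>i\<close> span \<open>\<gg>\<close>, every
    \<open>x\<^sub>1 \<and> \<dots> \<and> x\<^sub>n\<^sub>-\<^sub>2 \<and> a\<close> is \<open>0\<close>, and (R2) is trivial.

  A representation also presupposes that \<open>\<L>\<close> is a Leibniz algebra and that all products are well defined
  on the quotient that is the exterior power. Identities in \<open>\<L>\<close> are verified by linear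
  functionals, which separate its points (\<open>ext_power_eqI\<close>). A functional restricts to an alternating form
  on lists, and left multiplication by \<open>X\<close> acts on this form by the Leibniz rule with the
  endomorphism \<open>[x\<^sub>1, \<dots>, x\<^sub>n\<^sub>-\<^sub>1, -]\<close> (\<open>der\<close>). The Leibniz identity of \<open>\<L>\<close> thus becomes the commutator
  formula \<open>der_commutator\<close> together with the Filippov identity.
\<close>


section \<open>Linear maps and alternating multilinear maps\<close>

text \<open>
  A basis of the span stays independent when \<open>x\<close> is added, so the values on it can be
  prescribed. This gives both the functionals that separate the points of an exterior power
  and the maps \<open>\<phi>\<close> by which the condition (R2) is extracted from a representation.
\<close>

lemma exists_linear_vanishing_on_span:
  assumes "vector_space s1" "vector_space s2" "x \<notin> module.span s1 S"
  obtains f where "Vector_Spaces.linear s1 s2 f" "f x = v" "\<And>y. y \<in> module.span s1 S \<Longrightarrow> f y = 0"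
proof -
  interpret vector_space_pair s1 s2
    using assms by (simp add: vector_space_pair_def)
  obtain B where B: "B \<subseteq> vs1.span S" "vs1.independent B" "vs1.span S \<subseteq> vs1.span B"
    using vs1.maximal_independent_subset by blast
  then have "vs1.span B = vs1.span S"
    by (metis subset_antisym vs1.span_mono vs1.span_span)
  then have x: "x \<notin> vs1.span B" using assms by simp
  then have "x \<notin> B" using vs1.span_base by blast
  from x B(2) have "vs1.independent (insert x B)" by (rule vs1.independent_insertI)
  then obtain f where f: "Vector_Spaces.linear s1 s2 f"
    "\<forall>b\<in>insert x B. f b = (if b = x then v else 0)"
    using linear_independent_extend[of "insert x B" "\<lambda>b. if b = x then v else 0"] by blast
  have "f b = 0" if "b \<in> B" for b
    using f(2) \<open>x \<notin> B\<close> that by auto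
  then have "f y = 0" if "y \<in> vs1.span S" for y
    using linear_eq_0_on_span[OF f(1), of B y] B(3) that by blast
  with f show ?thesis by (intro that[of f]) auto
qed

lemma split_at_repeated_entry:
  assumes "i < j" "j < length xs" "xs ! i = xs ! j"
  obtains us a vs ws where "xs = us @ a # vs @ a # ws" "length us = i" "length vs = j - Suc i"
proof
  show "xs = take i xs @ xs ! i # take (j - Suc i) (drop (Suc i) xs) @ xs ! i # drop (Suc j) xs"
    using assms id_take_nth_drop[of i xs] id_take_nth_drop[of "j - Suc i" "drop (Suc i) xs"]
    by (simp add: add.commute)
qed (use assms in simp_all)

lemma alternating_multilinearI:
  assumes "vector_space s1" "vector_space s2"
    and "\<And>xs i x y. length xs = k \<Longrightarrow> i < k \<Longrightarrow> f (xs[i := x + y]) = f (xs[i := x]) + f (xs[i := y])"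
    and "\<And>xs i c x. length xs = k \<Longrightarrow> i < k \<Longrightarrow> f (xs[i := s1 c x]) = s2 c (f (xs[i := x]))"
    and "\<And>xs i j. length xs = k \<Longrightarrow> i < j \<Longrightarrow> j < k \<Longrightarrow> xs ! i = xs ! j \<Longrightarrow> f xs = 0"
  shows "alternating_multilinear k s1 s2 f"
  using assms by (auto simp: alternating_multilinear_def Vector_Spaces.linear_iff)

context
  fixes k s1 s2 f
  assumes f: "alternating_multilinear k s1 s2 f"
begin

lemma alternating_multilinear_linear:
  "length xs = k \<Longrightarrow> i < k \<Longrightarrow> Vector_Spaces.linear s1 s2 (\<lambda>x. f (xs[i := x]))"
  using f by (simp add: alternating_multilinear_def)

lemma alternating_multilinear_linear_append:
  assumes "length us + length vs + 1 = k"
  shows "Vector_Spaces.linear s1 s2 (\<lambda>x. f (us @ x # vs))"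
  using alternating_multilinear_linear[of "us @ undefined # vs" "length us"] assms by simp

lemma alternating_multilinear_eq_0:
  "length xs = k \<Longrightarrow> i < k \<Longrightarrow> j < k \<Longrightarrow> i \<noteq> j \<Longrightarrow> xs ! i = xs ! j \<Longrightarrow> f xs = 0"
  using f unfolding alternating_multilinear_def by (metis linorder_neqE_nat)

lemma alternating_multilinear_not_distinct:
  "length xs = k \<Longrightarrow> \<not> distinct xs \<Longrightarrow> f xs = 0"
  using alternating_multilinear_eq_0 by (auto simp: distinct_conv_nth)

text \<open>Expand \<open>f (\<dots>, x + y, \<dots>, x + y, \<dots>) = 0\<close>.\<close>

lemma alternating_multilinear_swap:
  assumes "length us + length vs + length ws + 2 = k"
  shows "f (us @ x # vs @ y # ws) = - f (us @ y # vs @ x # ws)"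
proof -
  have l1: "f (us @ (a + b) # vs @ c # ws) = f (us @ a # vs @ c # ws) + f (us @ b # vs @ c # ws)"
    for a b c
    using alternating_multilinear_linear_append[of us "vs @ c # ws"] assms
    by (simp add: Vector_Spaces.linear_iff)
  have l2: "f (us @ c # vs @ (a + b) # ws) = f (us @ c # vs @ a # ws) + f (us @ c # vs @ b # ws)"
    for a b c
    using alternating_multilinear_linear_append[of "us @ c # vs" "ws"] assms
    by (simp add: Vector_Spaces.linear_iff)
  have z: "f (us @ a # vs @ a # ws) = 0" for a
    using assms by (intro alternating_multilinear_not_distinct) auto
  have "f (us @ x # vs @ y # ws) + f (us @ y # vs @ x # ws) = f (us @ (x + y) # vs @ (x + y) # ws)"
    by (simp only: l1 l2) (simp add: z)
  also have "\<dots> = 0" by (rule z)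
  finally show ?thesis by (simp only: eq_neg_iff_add_eq_0)
qed

text \<open>
  Moving \<open>a\<close> past one entry of \<open>vs\<close> is an adjacent transposition.
\<close>

lemma alternating_multilinear_move:
  assumes "length us + length vs + length ws + 1 = k"
  shows "f (us @ a # vs @ ws) = s2 ((-1) ^ length vs) (f (us @ vs @ a # ws))"
  using assms
proof (induction vs arbitrary: us)
  case Nil
  then have "vector_space s2"
    using alternating_multilinear_linear_append[of us ws] by (simp add: Vector_Spaces.linear_iff)
  then show ?case by (simp add: vector_space_def)
next
  case (Cons b vs)
  have s2: "vector_space s2"
    using alternating_multilinear_linear_append[of us "b # vs @ ws"] Cons.prems
    by (simp add: Vector_Spaces.linear_iff)
  interpret s2: vector_space s2 by fact
  have "f (us @ a # (b # vs) @ ws) = - f ((us @ [b]) @ a # vs @ ws)"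
    using alternating_multilinear_swap[of us "[]" "vs @ ws" a b] Cons.prems by simp
  also have "\<dots> = - s2 ((-1) ^ length vs) (f ((us @ [b]) @ vs @ a # ws))"
    using Cons.IH[of "us @ [b]"] Cons.prems by simp
  finally show ?case by (simp add: s2.scale_minus_left)
qed

end

lemma alternating_multilinear_add:
  assumes "alternating_multilinear k s1 s2 f" "alternating_multilinear k s1 s2 g"
  shows "alternating_multilinear k s1 s2 (\<lambda>xs. f xs + g xs)"
  using assms by (auto simp: alternating_multilinear_def Vector_Spaces.linear_iff vector_space_def
    algebra_simps)

lemma alternating_multilinear_compose:
  assumes "alternating_multilinear k s1 s2 f" "Vector_Spaces.linear s2 s3 h"
  shows "alternating_multilinear k s1 s3 (\<lambda>xs. h (f xs))"
proof -
  have "h 0 = 0" using assms(2) by (metis Vector_Spaces.linear.axioms(3) module_hom.zero)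
  with assms show ?thesis by (auto simp: alternating_multilinear_def Vector_Spaces.linear_iff)
qed

lemma linear_scale_right: "vector_space s \<Longrightarrow> Vector_Spaces.linear s s (s c)"
  by (auto simp: Vector_Spaces.linear_iff vector_space_def mult.commute)

lemma alternating_multilinear_diff:
  assumes "alternating_multilinear k s1 s2 f" "alternating_multilinear k s1 s2 g"
    "vector_space s2"
  shows "alternating_multilinear k s1 s2 (\<lambda>xs. f xs - g xs)"
  using alternating_multilinear_add[OF assms(1)
    alternating_multilinear_compose[OF assms(2) linear_scale_right[OF assms(3), of "-1"]]] assms(3)
  by (simp add: module.scale_minus_left module_iff_vector_space[symmetric] module.scale_one)

lemma linear_sum_scaled:
  assumes "vector_space s1" "vector_space s2" "\<And>i. i \<in> I \<Longrightarrow> Vector_Spaces.linear s1 s2 (g i)"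
  shows "Vector_Spaces.linear s1 s2 (\<lambda>x. \<Sum>i\<in>I. g i x)"
  using assms
  by (auto simp: Vector_Spaces.linear_iff sum.distrib
      module.scale_sum_right[OF assms(2)[folded module_iff_vector_space]])

lemma alternating_multilinear_cong:
  assumes "alternating_multilinear k s1 s2 f" "\<And>xs. length xs = k \<Longrightarrow> f xs = g xs"
  shows "alternating_multilinear k s1 s2 g"
  using assms(1) by (simp add: alternating_multilinear_def assms(2)[symmetric])

lemma alternating_multilinear_sum:
  assumes "vector_space s1" "vector_space s2" "\<And>i. i \<in> I \<Longrightarrow> alternating_multilinear k s1 s2 (f i)"
  shows "alternating_multilinear k s1 s2 (\<lambda>xs. \<Sum>i\<in>I. f i xs)"
proof -
  have "Vector_Spaces.linear s1 s2 (\<lambda>x. \<Sum>i\<in>I. f i (xs[j := x]))" if "length xs = k" "j < k" for xs j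
    using assms that by (intro linear_sum_scaled) (auto simp: alternating_multilinear_def)
  moreover have "(\<Sum>i\<in>I. f i xs) = 0" if "length xs = k" "j < l" "l < k" "xs ! j = xs ! l" for xs j l
    using assms(3) that by (intro sum.neutral) (auto simp: alternating_multilinear_def)
  ultimately show ?thesis by (auto simp: alternating_multilinear_def)
qed

lemma alternating_multilinear_butlast:
  assumes "alternating_multilinear k s1 s2 f" "0 < k"
  shows "alternating_multilinear (k - 1) s1 s2 (\<lambda>xs. f (xs @ [z]))"
proof -
  have "Vector_Spaces.linear s1 s2 (\<lambda>x. f (xs[i := x] @ [z]))" if "length xs = k - 1" "i < k - 1"
    for xs i
    using alternating_multilinear_linear[OF assms(1), of "xs @ [z]" i] that
    by (simp add: list_update_append)
  moreover have "f (xs @ [z]) = 0" if "length xs = k - 1" "i < j" "j < k - 1" "xs ! i = xs ! j"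
    for xs i j
    using alternating_multilinear_eq_0[OF assms(1), of "xs @ [z]" i j] that by (simp add: nth_append)
  ultimately show ?thesis by (simp add: alternating_multilinear_def)
qed


section \<open>Derivations acting on multilinear maps\<close>

text \<open>
  For an endomorphism \<open>D\<close>, this is the Leibniz-rule action of \<open>D\<close> on functions of lists, i.e.
  the transpose of the derivation that \<open>D\<close> induces on exterior powers. If \<open>F\<close> is the
  restriction of a linear map to wedges and \<open>D\<close> the bracket with \<open>n - 1\<close> fixed entries, it
  describes left multiplication in the Leibniz algebra \<open>\<L>\<close>.
\<close>

definition der :: "('g \<Rightarrow> 'g) \<Rightarrow> ('g list \<Rightarrow> 'b::comm_monoid_add) \<Rightarrow> 'g list \<Rightarrow> 'b"
  where "der D F zs = (\<Sum>i<length zs. F (zs[i := D (zs ! i)]))"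

lemma der_Nil [simp]: "der D F [] = 0"
  by (simp add: der_def)

lemma der_Cons [simp]: "der D F (z # zs) = F (D z # zs) + der D (\<lambda>ws. F (z # ws)) zs"
  by (simp add: der_def sum.lessThan_Suc_shift del: sum.lessThan_Suc)

lemma der_append:
  "der D F (us @ vs) = der D (\<lambda>ws. F (ws @ vs)) us + der D (\<lambda>ws. F (us @ ws)) vs"
  by (induction us arbitrary: F) (simp_all add: add.assoc)

lemma der_cong:
  "(\<And>ws. length ws = length zs \<Longrightarrow> F ws = G ws) \<Longrightarrow> der D F zs = der D G zs"
  by (simp add: der_def)

lemma der_add: "der D (\<lambda>zs. F zs + G zs) zs = der D F zs + der D G zs"
  by (simp add: der_def sum.distrib)

lemma der_sum: "der D (\<lambda>zs. \<Sum>i\<in>I. F i zs) zs = (\<Sum>i\<in>I. der D (F i) zs)"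
  by (induction I rule: infinite_finite_induct) (simp_all add: der_add, simp_all add: der_def)

lemma der_diff:
  fixes F G :: "'g list \<Rightarrow> 'b::ab_group_add"
  shows "der D (\<lambda>zs. F zs - G zs) zs = der D F zs - der D G zs"
  by (simp add: der_def sum_subtractf)

lemma linear_der:
  assumes "Vector_Spaces.linear s1 s2 h"
  shows "h (der D F zs) = der D (\<lambda>zs. h (F zs)) zs"
  using module_hom.sum[OF Vector_Spaces.linear.axioms(3)[OF assms]] by (simp add: der_def)

text \<open>
  The position at which \<open>D\<close> acts is either one that survives in \<open>omit i zs\<close> or the omitted
  position itself. The function \<open>H\<close> receives the omitted entry as a separate argument.
\<close>

lemma der_omit:
  assumes "i < length zs"
  shows "der D (\<lambda>ws. H (omit i ws) (ws ! i)) zs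
    = der D (\<lambda>ws. H ws (zs ! i)) (omit i zs) + H (omit i zs) (D (zs ! i))"
  using assms
proof (induction zs arbitrary: i H)
  case (Cons z zs)
  show ?case
  proof (cases i)
    case 0
    then show ?thesis by (simp add: omit_def add.commute)
  next
    case (Suc j)
    then show ?thesis
      using Cons.IH[of j "\<lambda>ws. H (z # ws)"] Cons.prems by (simp add: omit_def add_ac)
  qed
qed simp

text \<open>
  The terms in which \<open>D\<close> and \<open>E\<close> act at two different positions occur in both products, so
  only those remain in which they act at the same position.
\<close>

lemma der_der_diff:
  fixes F :: "'g list \<Rightarrow> 'b::ab_group_add"
  shows "der D (der E F) zs - der E (der D F) zs
    = (\<Sum>i<length zs. F (zs[i := E (D (zs ! i))]) - F (zs[i := D (E (zs ! i))]))"
proof (induction zs arbitrary: F)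
  case (Cons z zs)
  have *: "der A (\<lambda>ws. F (B z # ws) + der B (\<lambda>us. F (z # us)) ws) zs
     = der A (\<lambda>ws. F (B z # ws)) zs + der A (der B (\<lambda>us. F (z # us))) zs" for A B
    by (simp add: der_add)
  show ?case
    using Cons.IH[of "\<lambda>us. F (z # us)"]
    by (simp add: * sum.lessThan_Suc_shift del: sum.lessThan_Suc algebra_simps)
qed simp

text \<open>Multilinearity combines the two values that are left at each position.\<close>

lemma der_commutator:
  fixes F :: "'g::ab_group_add list \<Rightarrow> 'b::ab_group_add"
  assumes "alternating_multilinear k s1 s2 F" "length zs = k"
  shows "der D (der E F) zs - der E (der D F) zs = der (\<lambda>x. E (D x) - D (E x)) F zs"
  unfolding der_der_diff der_def[of _ F]
proof (intro sum.cong refl)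
  fix i assume "i \<in> {..<length zs}"
  then have "Vector_Spaces.linear s1 s2 (\<lambda>x. F (zs[i := x]))"
    using alternating_multilinear_linear[OF assms] assms(2) by simp
  then show "F (zs[i := E (D (zs ! i))]) - F (zs[i := D (E (zs ! i))])
     = F (zs[i := E (D (zs ! i)) - D (E (zs ! i))])"
    by (rule module_hom.diff[OF Vector_Spaces.linear.axioms(3), symmetric])
qed

text \<open>
  If two entries agree, the terms at all other positions vanish, and the terms at these two
  positions differ by a transposition.
\<close>

lemma alternating_multilinear_der:
  assumes F: "alternating_multilinear k s1 s2 F" and D: "Vector_Spaces.linear s1 s1 D"
    and s2: "vector_space s2"
  shows "alternating_multilinear k s1 s2 (der D F)"
proof -
  have s1: "vector_space s1" using D by (simp add: Vector_Spaces.linear_iff)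
  have lin: "Vector_Spaces.linear s1 s2 (\<lambda>x. der D F (xs[i := x]))" if "length xs = k" "i < k"
    for xs i
  proof -
    have "Vector_Spaces.linear s1 s2 (\<lambda>x. F (xs[i := x, j := D (xs[i := x] ! j)]))" if "j < k" for j
    proof (cases "j = i")
      case True
      have "Vector_Spaces.linear s1 s2 ((\<lambda>x. F (xs[i := x])) \<circ> D)"
        by (rule Vector_Spaces.linear_compose[OF D])
          (use alternating_multilinear_linear[OF F] \<open>length xs = k\<close> \<open>i < k\<close> in auto)
      with True show ?thesis using \<open>length xs = k\<close> \<open>i < k\<close> by (simp add: o_def)
    next
      case False
      then show ?thesis
        using alternating_multilinear_linear[OF F, of "xs[j := D (xs ! j)]" i] \<open>length xs = k\<close> \<open>i < k\<close>
        by (simp add: list_update_swap)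
    qed
    then show ?thesis unfolding der_def
      using that by (auto intro!: linear_sum_scaled s1 s2)
  qed
  have "der D F xs = 0" if xs: "length xs = k" "i < j" "j < k" "xs ! i = xs ! j" for xs i j
  proof -
    obtain us a vs ws where e: "xs = us @ a # vs @ a # ws"
      by (rule split_at_repeated_entry[of i j xs]) (use xs that in \<open>simp_all only:\<close>)
    have z: "F ys = 0" if "length ys = k" "\<not> distinct ys" for ys
      using alternating_multilinear_not_distinct[OF F] that by simp
    have "der D (\<lambda>ys. F (ys @ a # vs @ a # ws)) us = 0" "der D (\<lambda>ys. F (us @ a # ys @ a # ws)) vs = 0"
      "der D (\<lambda>ys. F (us @ a # vs @ a # ys)) ws = 0"
      using xs(1) unfolding e by (auto simp: der_def intro!: sum.neutral z)
    moreover have "F (us @ D a # vs @ a # ws) = - F (us @ a # vs @ D a # ws)"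
      by (rule alternating_multilinear_swap[OF F]) (use xs(1) in \<open>simp add: e\<close>)
    ultimately show ?thesis unfolding e by (simp add: der_append)
  qed
  with lin show ?thesis by (auto simp: alternating_multilinear_def)
qed


section \<open>Linear maps on an exterior power\<close>

lemma ext_class_eq_iff:
  "ext_class s k a = ext_class s k b \<longleftrightarrow> a - b \<in> free.span (ext_relators s k)"
proof
  assume "ext_class s k a = ext_class s k b"
  moreover have "a \<in> ext_class s k a"
    using free.span_zero[of "ext_relators s k"] by (force simp: ext_class_def elt_set_plus_def)
  ultimately show "a - b \<in> free.span (ext_relators s k)"
    by (auto simp: ext_class_def elt_set_plus_def)
next
  assume ab: "a - b \<in> free.span (ext_relators s k)"
  have "c +o free.span R \<subseteq> d +o free.span R" if cd: "c - d \<in> free.span R" for c d and R ::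
    "('x \<Rightarrow>\<^sub>0 'y::field) set"
  proof
    fix y assume "y \<in> c +o free.span R"
    then obtain r where "r \<in> free.span R" "y = c + r" by (auto simp: elt_set_plus_def)
    with free.span_add[OF cd this(1)] show "y \<in> d +o free.span R"
      unfolding elt_set_plus_def by (intro CollectI bexI[of _ "c - d + r"]) auto
  qed
  from this[OF ab] this[of b a] free.span_neg[OF ab] show "ext_class s k a = ext_class s k b"
    by (auto simp: ext_class_def)
qed

lemma free_scale_single: "free_scale c (Poly_Mapping.single xs d) = Poly_Mapping.single xs (c * d)"
  by (auto intro!: poly_mapping_eqI simp: lookup_single when_def)

lemma wedge_in_ext_power: "length xs = k \<Longrightarrow> wedge s xs \<in> carrier (ext_power s k)"
  by (auto simp: ext_power_simps wedge_def free_lists_def)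

lemma wedge_add:
  assumes "length xs = k" "i < k"
  shows "wedge s (xs[i := x + y]) = wedge s (xs[i := x]) \<oplus>\<^bsub>ext_power s k\<^esub> wedge s (xs[i := y])"
proof -
  have "Poly_Mapping.single (xs[i := x + y]) 1
       - Poly_Mapping.single (xs[i := x]) 1 - Poly_Mapping.single (xs[i := y]) 1 \<in> ext_relators s k"
    using assms unfolding ext_relators_def by blast
  then show ?thesis
    using assms by (simp add: wedge_def ext_power_simps ext_class_eq_iff free.span_base diff_diff_eq)
qed

lemma wedge_scale:
  assumes "length xs = k" "i < k"
  shows "wedge s (xs[i := s c x]) = c \<odot>\<^bsub>ext_power s k\<^esub> wedge s (xs[i := x])"
proof -
  have "Poly_Mapping.single (xs[i := s c x]) 1
    - Poly_Mapping.single (xs[i := x]) c \<in> ext_relators s k"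
    using assms unfolding ext_relators_def by blast
  then show ?thesis
    using assms
    by (simp add: wedge_def ext_power_simps ext_class_eq_iff free.span_base free_scale_single)
qed

lemma wedge_alternating:
  assumes "length xs = k" "i < j" "j < k" "xs ! i = xs ! j"
  shows "wedge s xs = \<zero>\<^bsub>ext_power s k\<^esub>"
proof -
  have "Poly_Mapping.single xs 1 \<in> ext_relators s k"
    using assms unfolding ext_relators_def by blast
  then show ?thesis
    using assms(1) by (simp add: wedge_def ext_power_simps ext_class_eq_iff free.span_base)
qed

lemma ext_power_smult_closed:
  fixes s :: "'k::field \<Rightarrow> 'a::ab_group_add \<Rightarrow> 'a"
  assumes "A \<in> carrier (ext_power s k)"
  shows "c \<odot>\<^bsub>ext_power s k\<^esub> A \<in> carrier (ext_power s k)"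
proof -
  interpret L: Module.module "K_ring :: 'k ring" "ext_power s k" by (rule module_ext_power)
  show ?thesis using L.smult_closed[of c A] assms by (simp add: ring_of_type_algebra_def)
qed

lemma ext_power_add_closed:
  fixes s :: "'k::field \<Rightarrow> 'a::ab_group_add \<Rightarrow> 'a"
  assumes "A \<in> carrier (ext_power s k)" "B \<in> carrier (ext_power s k)"
  shows "A \<oplus>\<^bsub>ext_power s k\<^esub> B \<in> carrier (ext_power s k)"
proof -
  interpret L: Module.module "K_ring :: 'k ring" "ext_power s k" by (rule module_ext_power)
  show ?thesis using assms by (rule L.add.m_closed)
qed

text \<open>
  Every representative is a linear combination of single lists, and the class of a list is its
  wedge. The zero vector is covered as \<open>0\<close> times a wedge.
\<close>

lemma ext_power_induct [consumes 1, case_names wedge add smult]: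
  assumes "A \<in> carrier (ext_power s k)"
    and wedge: "\<And>xs. length xs = k \<Longrightarrow> P (wedge s xs)"
    and add: "\<And>A B. A \<in> carrier (ext_power s k) \<Longrightarrow> B \<in> carrier (ext_power s k) \<Longrightarrow> P A \<Longrightarrow> P B
      \<Longrightarrow> P (A \<oplus>\<^bsub>ext_power s k\<^esub> B)"
    and smult: "\<And>c A. A \<in> carrier (ext_power s k) \<Longrightarrow> P A \<Longrightarrow> P (c \<odot>\<^bsub>ext_power s k\<^esub> A)"
  shows "P A"
proof -
  obtain a where a: "a \<in> free_lists k" "A = ext_class s k a"
    using assms(1) by (auto simp: ext_power_simps)
  have single: "P (ext_class s k (Poly_Mapping.single xs c))" if "length xs = k" for xs c
  proof -
    have "c \<odot>\<^bsub>ext_power s k\<^esub> wedge s xs = ext_class s k (free_scale c (Poly_Mapping.single xs 1))"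
      using that by (simp add: wedge_def ext_power_simps)
    then show ?thesis
      using smult[OF wedge_in_ext_power wedge, of xs c] that by (simp add: free_scale_single)
  qed
  have "P (ext_class s k a)" if "finite T" "Poly_Mapping.keys a \<subseteq> T" "T \<subseteq> {xs. length xs = k}" for a T
    using that
  proof (induction T arbitrary: a rule: finite_induct)
    case empty
    then have "a = Poly_Mapping.single (replicate k undefined) 0" by simp
    then show ?case using single[of "replicate k undefined" 0] by simp
  next
    case (insert xs T)
    define b where "b = a - Poly_Mapping.single xs (Poly_Mapping.lookup a xs)"
    have b: "Poly_Mapping.keys b \<subseteq> T"
      using insert.prems(1) by (auto simp: b_def in_keys_iff lookup_minus lookup_single when_def
        split: if_splits)
    then have "P (ext_class s k b \<oplus>\<^bsub>ext_power s k\<^esub> ext_class s k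
      (Poly_Mapping.single xs (Poly_Mapping.lookup a xs)))"
      using insert.IH[OF b] insert.prems(2) single
      by (intro add) (auto simp: ext_power_simps free_lists_def)
    then show ?case by (simp add: ext_power_simps b_def)
  qed
  from this[OF finite_keys order_refl] a show ?thesis by (auto simp: free_lists_def)
qed

text \<open>
  Here the target is a whole type, so that its sums are the ordinary ones and \<open>der\<close> can be
  applied to the values on wedges.
\<close>

definition ext_linear ::
  "('k::field \<Rightarrow> 'a::ab_group_add \<Rightarrow> 'a) \<Rightarrow> nat \<Rightarrow> ('k \<Rightarrow> 'b::ab_group_add \<Rightarrow> 'b)
    \<Rightarrow> (('a list \<Rightarrow>\<^sub>0 'k) set \<Rightarrow> 'b) \<Rightarrow> bool"
  where "ext_linear s k sw h \<longleftrightarrow>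
    (\<forall>A\<in>carrier (ext_power s k). \<forall>B\<in>carrier (ext_power s k). h (A \<oplus>\<^bsub>ext_power s k\<^esub> B) = h A + h B) \<and>
    (\<forall>c. \<forall>A\<in>carrier (ext_power s k). h (c \<odot>\<^bsub>ext_power s k\<^esub> A) = sw c (h A))"

lemma ext_linear_add:
  "ext_linear s k sw h \<Longrightarrow> A \<in> carrier (ext_power s k) \<Longrightarrow> B \<in> carrier (ext_power s k)
    \<Longrightarrow> h (A \<oplus>\<^bsub>ext_power s k\<^esub> B) = h A + h B"
  by (simp add: ext_linear_def)

lemma ext_linear_smult:
  "ext_linear s k sw h \<Longrightarrow> A \<in> carrier (ext_power s k) \<Longrightarrow> h (c \<odot>\<^bsub>ext_power s k\<^esub> A) = sw c (h A)"
  by (simp add: ext_linear_def)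

lemma ext_linear_zero:
  assumes "ext_linear s k sw h"
  shows "h \<zero>\<^bsub>ext_power s k\<^esub> = 0"
proof -
  interpret L: Module.module K_ring "ext_power s k" by (rule module_ext_power)
  show ?thesis
    using ext_linear_add[OF assms L.zero_closed L.zero_closed] by simp
qed

lemma ext_linear_finsum:
  assumes "ext_linear s k sw h" "finite I" "\<And>i. i \<in> I \<Longrightarrow> f i \<in> carrier (ext_power s k)"
  shows "h (\<Oplus>\<^bsub>ext_power s k\<^esub>i\<in>I. f i) = (\<Sum>i\<in>I. h (f i))"
proof -
  interpret L: Module.module K_ring "ext_power s k" by (rule module_ext_power)
  show ?thesis
    using assms(2,3)
    by (induction I rule: finite_induct)
      (simp_all add: ext_linear_zero[OF assms(1)] ext_linear_add[OF assms(1)] Pi_iff)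
qed

lemma ext_linear_wedge:
  assumes "ext_linear s k sw h" "vector_space s" "vector_space sw"
  shows "alternating_multilinear k s sw (\<lambda>xs. h (wedge s xs))"
  using assms
  by (intro alternating_multilinearI)
    (auto simp: wedge_add wedge_scale wedge_alternating ext_linear_add ext_linear_smult
      ext_linear_zero
      wedge_in_ext_power)

lemma ext_linear_eqI:
  assumes "ext_linear s k sw h" "ext_linear s k sw h'"
    and "\<And>xs. length xs = k \<Longrightarrow> h (wedge s xs) = h' (wedge s xs)"
    and "A \<in> carrier (ext_power s k)"
  shows "h A = h' A"
  using assms(4)
  by (induction rule: ext_power_induct)
    (simp_all add: assms(3) ext_linear_add[OF assms(1)] ext_linear_add[OF assms(2)]
      ext_linear_smult[OF assms(1)] ext_linear_smult[OF assms(2)])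

lemma ext_bilinear_eqI:
  assumes l: "\<And>B. B \<in> carrier (ext_power s k) \<Longrightarrow> ext_linear s k sw (\<lambda>A. f A B)"
      "\<And>A. A \<in> carrier (ext_power s k) \<Longrightarrow> ext_linear s k sw (\<lambda>B. f A B)"
    and r: "\<And>B. B \<in> carrier (ext_power s k) \<Longrightarrow> ext_linear s k sw (\<lambda>A. g A B)"
      "\<And>A. A \<in> carrier (ext_power s k) \<Longrightarrow> ext_linear s k sw (\<lambda>B. g A B)"
    and eq: "\<And>xs ys. length xs = k \<Longrightarrow> length ys = k
      \<Longrightarrow> f (wedge s xs) (wedge s ys) = g (wedge s xs) (wedge s ys)"
    and AB: "A \<in> carrier (ext_power s k)" "B \<in> carrier (ext_power s k)"
  shows "f A B = g A B"
proof -
  have "f (wedge s xs) B = g (wedge s xs) B" if "length xs = k" for xs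
    by (rule ext_linear_eqI[OF l(2) r(2) eq[OF that] AB(2)]) (rule wedge_in_ext_power[OF that])+
  then show ?thesis
    by (rule ext_linear_eqI[OF l(1)[OF AB(2)] r(1)[OF AB(2)] _ AB(1)])
qed

lemma vector_space_field: "vector_space ((*) :: 'k::field \<Rightarrow> 'k \<Rightarrow> 'k)"
  by unfold_locales (simp_all add: algebra_simps)

text \<open>
  Linear functionals separate the points of an exterior power: if two cosets differ, some
  functional on the free space vanishes on all relators but not on the difference of the
  representatives, and it descends to the quotient. By this principle identities between sums
  of wedges become identities between values of alternating forms.
\<close>

lemma ext_power_eqI:
  fixes s :: "'k::field \<Rightarrow> 'a::ab_group_add \<Rightarrow> 'a"
  assumes A: "A \<in> carrier (ext_power s k)" and B: "B \<in> carrier (ext_power s k)"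
    and h: "\<And>h. ext_linear s k ((*) :: 'k \<Rightarrow> 'k \<Rightarrow> 'k) h \<Longrightarrow> h A = h B"
  shows "A = B"
proof (rule ccontr)
  assume "A \<noteq> B"
  obtain a b where ab: "A = ext_class s k a" "B = ext_class s k b"
    using A B by (auto simp: ext_power_simps)
  with \<open>A \<noteq> B\<close> have "a - b \<notin> free.span (ext_relators s k)" by (simp add: ext_class_eq_iff)
  from exists_linear_vanishing_on_span[OF free.vector_space_axioms vector_space_field this, of 1]
  obtain g where g: "Vector_Spaces.linear free_scale (*) g" "g (a - b) = (1 :: 'k)"
    "\<And>r. r \<in> free.span (ext_relators s k) \<Longrightarrow> g r = 0" by blast
  define h where "h = (\<lambda>C. g (SOME c. c \<in> C))"
  have h_class: "h (ext_class s k c) = g c" for c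
  proof -
    have "c \<in> ext_class s k c"
      using free.span_zero[of "ext_relators s k"] by (force simp: ext_class_def elt_set_plus_def)
    then have "(SOME d. d \<in> ext_class s k c) \<in> ext_class s k c" by (rule someI)
    then obtain r where "r \<in> free.span (ext_relators s k)" "(SOME d. d \<in> ext_class s k c) = c + r"
      by (auto simp: ext_class_def elt_set_plus_def)
    with g show ?thesis by (simp add: h_def Vector_Spaces.linear_iff)
  qed
  have "ext_linear s k (*) h"
    using g(1) by (auto simp: ext_linear_def ext_power_simps h_class Vector_Spaces.linear_iff)
  from h[OF this] have "g a = g b" by (simp add: ab h_class)
  moreover have "g (a - b) = g a - g b"
    by (rule module_hom.diff[OF Vector_Spaces.linear.axioms(3)[OF g(1)]])
  ultimately show False using g(2) by simp
qed

text \<open>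
  The universal property for maps between exterior powers. Since functionals separate points,
  multilinearity and alternation may be tested after composing with a functional.
\<close>

context
  fixes s :: "'k::field \<Rightarrow> 'a::ab_group_add \<Rightarrow> 'a" and k l :: nat and f ::
    "'a list \<Rightarrow> ('a list \<Rightarrow>\<^sub>0 'k) set"
  assumes closed: "\<And>xs. length xs = k \<Longrightarrow> f xs \<in> carrier (ext_power s l)"
    and alt: "\<And>h. ext_linear s l ((*) :: 'k \<Rightarrow> 'k \<Rightarrow> 'k) h
      \<Longrightarrow> alternating_multilinear k s (*) (\<lambda>xs. h (f xs))"
begin

interpretation L: Module.module "K_ring :: 'k ring" "ext_power s l" by (rule module_ext_power)

private lemma additive:
  assumes "length xs = k" "i < k"
  shows "f (xs[i := x + y]) = f (xs[i := x]) \<oplus>\<^bsub>ext_power s l\<^esub> f (xs[i := y])"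
proof (rule ext_power_eqI)
  fix h assume h: "ext_linear s l ((*) :: 'k \<Rightarrow> 'k \<Rightarrow> 'k) h"
  show "h (f (xs[i := x + y])) = h (f (xs[i := x]) \<oplus>\<^bsub>ext_power s l\<^esub> f (xs[i := y]))"
    using assms alternating_multilinear_linear[OF alt[OF h] assms]
    by (simp add: ext_linear_add[OF h] closed Vector_Spaces.linear_iff)
qed (use assms closed in auto)

private lemma homogeneous:
  assumes "length xs = k" "i < k"
  shows "f (xs[i := s c x]) = c \<odot>\<^bsub>ext_power s l\<^esub> f (xs[i := x])"
proof (rule ext_power_eqI)
  fix h assume h: "ext_linear s l ((*) :: 'k \<Rightarrow> 'k \<Rightarrow> 'k) h"
  show "h (f (xs[i := s c x])) = h (c \<odot>\<^bsub>ext_power s l\<^esub> f (xs[i := x]))"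
    using assms alternating_multilinear_linear[OF alt[OF h] assms]
    by (simp add: ext_linear_smult[OF h] closed Vector_Spaces.linear_iff)
qed (use assms closed L.smult_closed in \<open>auto simp: ring_of_type_algebra_def\<close>)

private lemma alternating:
  assumes "length xs = k" "i < j" "j < k" "xs ! i = xs ! j"
  shows "f xs = \<zero>\<^bsub>ext_power s l\<^esub>"
proof (rule ext_power_eqI)
  fix h assume h: "ext_linear s l ((*) :: 'k \<Rightarrow> 'k \<Rightarrow> 'k) h"
  show "h (f xs) = h \<zero>\<^bsub>ext_power s l\<^esub>"
    using alternating_multilinear_eq_0[OF alt[OF h], of xs i j] assms
    by (simp add: ext_linear_zero[OF h])
qed (use assms closed in auto)

lemma ext_extend_wedge: "length xs = k \<Longrightarrow> extend (ext_power s l) f (wedge s xs) = f xs"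
  by (rule extend_wedge[OF module_ext_power closed additive homogeneous alternating])

lemma ext_extend_linear: "carrier_linear (ext_power s k) (ext_power s l) (extend (ext_power s l) f)"
  by (rule extend_linear[OF module_ext_power closed additive homogeneous alternating])

end

lemma hom_space_simps:
  "carrier (hom_space s1 s2) = {\<phi>. Vector_Spaces.linear s1 s2 \<phi>}"
  "\<zero>\<^bsub>hom_space s1 s2\<^esub> = (\<lambda>x. 0)"
  "\<phi> \<oplus>\<^bsub>hom_space s1 s2\<^esub> \<psi> = (\<lambda>x. \<phi> x + \<psi> x)"
  "c \<odot>\<^bsub>hom_space s1 s2\<^esub> \<phi> = (\<lambda>x. s2 c (\<phi> x))"
  by (simp_all add: hom_space_def)

lemma hom_space_minus:
  assumes "vector_space s1" "vector_space s2"
    "Vector_Spaces.linear s1 s2 \<phi>" "Vector_Spaces.linear s1 s2 \<psi>"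
  shows "\<phi> \<ominus>\<^bsub>hom_space s1 s2\<^esub> \<psi> = (\<lambda>x. \<phi> x - \<psi> x)"
proof -
  interpret H: Module.module K_ring "hom_space s1 s2" by (rule module_hom_space) fact+
  interpret V: vector_space_pair s1 s2 using assms by (simp add: vector_space_pair_def)
  have "\<ominus>\<^bsub>hom_space s1 s2\<^esub> \<psi> = (\<lambda>x. - \<psi> x)"
    using assms V.linear_compose_neg[OF assms(4)]
    by (intro H.minus_equality) (auto simp: hom_space_simps)
  then show ?thesis by (simp add: H.minus_eq hom_space_simps)
qed

text \<open>
  The universal property for maps into a space of linear maps, tested argument by argument.
\<close>

context
  fixes s :: "'k::field \<Rightarrow> 'a::ab_group_add \<Rightarrow> 'a" and s1 :: "'k \<Rightarrow> 'b::ab_group_add \<Rightarrow> 'b"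
    and s2 :: "'k \<Rightarrow> 'c::ab_group_add \<Rightarrow> 'c" and k and f :: "'a list \<Rightarrow> 'b \<Rightarrow> 'c"
  assumes s1: "vector_space s1" and s2: "vector_space s2"
    and lin: "\<And>xs. length xs = k \<Longrightarrow> Vector_Spaces.linear s1 s2 (f xs)"
    and alt: "\<And>z. alternating_multilinear k s s2 (\<lambda>xs. f xs z)"
begin

private lemma hom_alternating:
  assumes "length xs = k" "i < j" "j < k" "xs ! i = xs ! j"
  shows "f xs = \<zero>\<^bsub>hom_space s1 s2\<^esub>"
  using alternating_multilinear_eq_0[OF alt, of xs i j] assms
  by (simp add: hom_space_simps fun_eq_iff)

private lemma hom_closed: "length xs = k \<Longrightarrow> f xs \<in> carrier (hom_space s1 s2)"
  using lin by (simp add: hom_space_simps)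

private lemma hom_additive:
  assumes "length xs = k" "i < k"
  shows "f (xs[i := x + y]) = f (xs[i := x]) \<oplus>\<^bsub>hom_space s1 s2\<^esub> f (xs[i := y])"
  using alternating_multilinear_linear[OF alt assms]
  by (simp add: hom_space_simps Vector_Spaces.linear_iff fun_eq_iff)

private lemma hom_homogeneous:
  assumes "length xs = k" "i < k"
  shows "f (xs[i := s c x]) = c \<odot>\<^bsub>hom_space s1 s2\<^esub> f (xs[i := x])"
  using alternating_multilinear_linear[OF alt assms]
  by (simp add: hom_space_simps Vector_Spaces.linear_iff fun_eq_iff)

lemma hom_extend_wedge: "length xs = k \<Longrightarrow> extend (hom_space s1 s2) f (wedge s xs) = f xs"
  by (rule extend_wedge[OF module_hom_space[OF s1 s2] hom_closed hom_additive hom_homogeneous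
    hom_alternating])

lemma hom_extend_linear: "carrier_linear (ext_power s k) (hom_space s1 s2)
  (extend (hom_space s1 s2) f)"
  by (rule extend_linear[OF module_hom_space[OF s1 s2] hom_closed hom_additive hom_homogeneous
    hom_alternating])

end

lemma carrier_linear_closed: "carrier_linear L M F \<Longrightarrow> A \<in> carrier L \<Longrightarrow> F A \<in> carrier M"
  by (auto simp: carrier_linear_def)

lemma carrier_linear_hom_space_apply:
  "carrier_linear (ext_power s k) (hom_space s1 s2) F \<Longrightarrow> ext_linear s k s2 (\<lambda>A. F A z)"
  by (simp add: carrier_linear_def ext_linear_def hom_space_simps)

lemma carrier_linear_ext_power_compose:
  "carrier_linear (ext_power s k) (ext_power s l) F \<Longrightarrow> ext_linear s l sw h
    \<Longrightarrow> ext_linear s k sw (\<lambda>A. h (F A))"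
  by (auto simp: carrier_linear_def ext_linear_def Pi_iff)

lemma carrier_linear_compose:
  "carrier_linear L M F \<Longrightarrow> carrier_linear M N G \<Longrightarrow> carrier_linear L N (\<lambda>A. G (F A))"
  by (auto simp: carrier_linear_def Pi_iff)

lemma ext_linear_plus:
  "vector_space sw \<Longrightarrow> ext_linear s k sw h \<Longrightarrow> ext_linear s k sw h' \<Longrightarrow> ext_linear s k sw (\<lambda>A. h A + h' A)"
  by (auto simp: ext_linear_def vector_space_def)

lemma ext_linear_minus:
  "vector_space sw \<Longrightarrow> ext_linear s k sw h \<Longrightarrow> ext_linear s k sw h' \<Longrightarrow> ext_linear s k sw (\<lambda>A. h A - h' A)"
  by (auto simp: ext_linear_def module.scale_right_diff_distrib module_iff_vector_space[symmetric])


section \<open>The Leibniz algebra of an \<open>n\<close>-Lie algebra\<close>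

context n_Lie_algebra
begin

(* Otherwise the simplifier turns n - 1 into n - Suc 0, and facts about L no longer match. *)
declare One_nat_def [simp del]

abbreviation (input) ad :: "'g list \<Rightarrow> 'g \<Rightarrow> 'g"
  where "ad xs x \<equiv> br (xs @ [x])"

abbreviation (input) \<L>
  where "\<L> \<equiv> ext_power scale (n - 1)"

abbreviation (input) functional
  where "functional \<equiv> ext_linear scale (n - 1) ((*) :: 'k \<Rightarrow> 'k \<Rightarrow> 'k)"

abbreviation (input) product (infixl "\<bullet>" 75)
  where "A \<bullet> B \<equiv> circ scale n br A B"

lemma ad_alternating: "alternating_multilinear (n - 1) scale scale (\<lambda>xs. ad xs z)"
  using alternating_multilinear_butlast[OF br_alternating] n_ge_2 by simp

lemma ad_linear: "length xs = n - 1 \<Longrightarrow> Vector_Spaces.linear scale scale (ad xs)"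
  using alternating_multilinear_linear_append[OF br_alternating, of xs "[]"] n_ge_2 by simp

lemma ad_br: "length xs = n - 1 \<Longrightarrow> length zs = n \<Longrightarrow> ad xs (br zs) = der (ad xs) br zs"
  unfolding der_def by (simp only: Filippov)

text \<open>
  The Filippov identity with the contribution of the last entry \<open>z\<close> moved to the other side.
\<close>

lemma ad_der:
  assumes "length xs = n - 1" "length ys = n - 1"
  shows "der (ad xs) (\<lambda>ws. ad ws z) ys = ad xs (ad ys z) - ad ys (ad xs z)"
proof -
  have "ad xs (ad ys z) = der (ad xs) br (ys @ [z])"
    using n_ge_2 assms by (intro ad_br) auto
  then show ?thesis by (simp add: der_append)
qed

text \<open>
  The nested extensions that define the product are treated one at a time: \<open>circ_wedge\<close> is the
  product of two wedges, and \<open>circ_left xs\<close> is its linear extension in the second factor.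
\<close>

definition circ_wedge :: "'g list \<Rightarrow> 'g list \<Rightarrow> ('g list \<Rightarrow>\<^sub>0 'k) set"
  where "circ_wedge xs ys = (\<Oplus>\<^bsub>\<L>\<^esub>i\<in>{..<n - 1}. wedge scale (ys[i := ad xs (ys ! i)]))"

definition circ_left :: "'g list \<Rightarrow> ('g list \<Rightarrow>\<^sub>0 'k) set \<Rightarrow> ('g list \<Rightarrow>\<^sub>0 'k) set"
  where "circ_left xs = extend \<L> (circ_wedge xs)"

lemma circ_wedge_closed:
  assumes "length ys = n - 1"
  shows "circ_wedge xs ys \<in> carrier \<L>"
proof -
  interpret L: Module.module "K_ring :: 'k ring" \<L> by (rule module_ext_power)
  show ?thesis
    unfolding circ_wedge_def using assms by (intro L.finsum_closed) (auto intro: wedge_in_ext_power)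
qed

lemma ext_linear_circ_wedge:
  assumes "ext_linear scale (n - 1) sw h" "length ys = n - 1"
  shows "h (circ_wedge xs ys) = der (ad xs) (\<lambda>ws. h (wedge scale ws)) ys"
  unfolding circ_wedge_def
  by (subst ext_linear_finsum[OF assms(1)])
    (use assms(2) in \<open>auto intro: wedge_in_ext_power simp: der_def\<close>)

lemma functional_wedge:
  "functional h \<Longrightarrow> alternating_multilinear (n - 1) scale (*) (\<lambda>xs. h (wedge scale xs))"
  by (rule ext_linear_wedge) (use vector_space_axioms vector_space_field in auto)

lemma circ_wedge_alternating:
  assumes "length xs = n - 1" "functional h"
  shows "alternating_multilinear (n - 1) scale (*) (\<lambda>ys. h (circ_wedge xs ys))"
  using alternating_multilinear_der[OF functional_wedge[OF assms(2)] ad_linear[OF assms(1)]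
    vector_space_field]
  by (rule alternating_multilinear_cong) (simp add: ext_linear_circ_wedge[OF assms(2)])

lemma circ_left_wedge:
  "length xs = n - 1 \<Longrightarrow> length ys = n - 1 \<Longrightarrow> circ_left xs (wedge scale ys) = circ_wedge xs ys"
  unfolding circ_left_def by (rule ext_extend_wedge) (assumption | rule circ_wedge_closed
    circ_wedge_alternating)+

lemma circ_left_linear: "length xs = n - 1 \<Longrightarrow> carrier_linear \<L> \<L> (circ_left xs)"
  unfolding circ_left_def by (rule ext_extend_linear) (assumption | rule circ_wedge_closed
    circ_wedge_alternating)+

lemma circ_left_closed: "length xs = n - 1 \<Longrightarrow> A \<in> carrier \<L> \<Longrightarrow> circ_left xs A \<in> carrier \<L>"
  by (rule carrier_linear_closed[OF circ_left_linear])

text \<open>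
  Multilinearity and alternation are inherited by sums and multiples, so that \<open>B\<close> may be taken
  to be a wedge; there they come from the dependence of \<open>[x\<^sub>1, \<dots>, x\<^sub>n\<^sub>-\<^sub>1, -]\<close> on the \<open>x\<^sub>i\<close>.
\<close>

lemma circ_left_alternating:
  assumes "B \<in> carrier \<L>" and h: "functional h"
  shows "alternating_multilinear (n - 1) scale (*) (\<lambda>xs. h (circ_left xs B))"
  using assms(1)
proof (induction rule: ext_power_induct)
  case (wedge ys)
  have "alternating_multilinear (n - 1) scale (*)
      (\<lambda>xs. \<Sum>i<n - 1. h (wedge scale (ys[i := ad xs (ys ! i)])))"
    using alternating_multilinear_compose[OF ad_alternating
        alternating_multilinear_linear[OF functional_wedge[OF h] wedge]]
    by (intro alternating_multilinear_sum vector_space_axioms vector_space_field) auto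
  then show ?case
    by (rule alternating_multilinear_cong)
      (use wedge in \<open>simp add: circ_left_wedge ext_linear_circ_wedge[OF h] der_def\<close>)
next
  case (add A B)
  have hc: "ext_linear scale (n - 1) (*) (\<lambda>A. h (circ_left xs A))" if "length xs = n - 1" for xs
    by (rule carrier_linear_ext_power_compose[OF circ_left_linear[OF that] h])
  from add(3,4) have "alternating_multilinear (n - 1) scale (*)
    (\<lambda>xs. h (circ_left xs A) + h (circ_left xs B))"
    by (rule alternating_multilinear_add)
  then show ?case
    by (rule alternating_multilinear_cong) (simp add: ext_linear_add[OF hc] add)
next
  case (smult c A)
  have hc: "ext_linear scale (n - 1) (*) (\<lambda>A. h (circ_left xs A))" if "length xs = n - 1" for xs
    by (rule carrier_linear_ext_power_compose[OF circ_left_linear[OF that] h])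
  from smult(2) have "alternating_multilinear (n - 1) scale (*) (\<lambda>xs. c * h (circ_left xs A))"
    by (rule alternating_multilinear_compose[OF _ linear_scale_right[OF vector_space_field]])
  then show ?case
    by (rule alternating_multilinear_cong) (simp add: ext_linear_smult[OF hc] smult)
qed

lemma circ_eq_extend: "A \<bullet> B = extend \<L> (\<lambda>xs. circ_left xs B) A"
  by (simp add: circ_def circ_left_def circ_wedge_def[abs_def] Let_def)

lemma circ_wedge_left:
  "length xs = n - 1 \<Longrightarrow> B \<in> carrier \<L> \<Longrightarrow> wedge scale xs \<bullet> B = circ_left xs B"
  unfolding circ_eq_extend by (rule ext_extend_wedge) (assumption | rule circ_left_closed
    circ_left_alternating)+

lemma circ_linear_left: "B \<in> carrier \<L> \<Longrightarrow> carrier_linear \<L> \<L> (\<lambda>A. A \<bullet> B)"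
  unfolding circ_eq_extend by (rule ext_extend_linear) (assumption | rule circ_left_closed
    circ_left_alternating)+

lemma circ_closed: "A \<in> carrier \<L> \<Longrightarrow> B \<in> carrier \<L> \<Longrightarrow> A \<bullet> B \<in> carrier \<L>"
  by (rule carrier_linear_closed[OF circ_linear_left])

lemma circ_linear_right:
  assumes "A \<in> carrier \<L>"
  shows "carrier_linear \<L> \<L> (circ scale n br A)"
proof -
  have hl: "ext_linear scale (n - 1) (*) (\<lambda>A. h (A \<bullet> B))"
    if "B \<in> carrier \<L>" "functional h" for B h
    by (rule carrier_linear_ext_power_compose[OF circ_linear_left[OF that(1)] that(2)])
  have hr: "ext_linear scale (n - 1) (*) (\<lambda>B. h (circ_left xs B))"
    if "length xs = n - 1" "functional h" for xs h
    by (rule carrier_linear_ext_power_compose[OF circ_left_linear[OF that(1)] that(2)])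
  have add: "A \<bullet> (B \<oplus>\<^bsub>\<L>\<^esub> C) = A \<bullet> B \<oplus>\<^bsub>\<L>\<^esub> A \<bullet> C"
    if BC: "B \<in> carrier \<L>" "C \<in> carrier \<L>" for B C
  proof (rule ext_power_eqI)
    fix h assume h: "functional h"
    have "h (A \<bullet> (B \<oplus>\<^bsub>\<L>\<^esub> C)) = h (A \<bullet> B) + h (A \<bullet> C)"
      by (rule ext_linear_eqI[OF hl ext_linear_plus[OF vector_space_field hl hl] _ assms])
        (use BC h in \<open>auto simp: circ_wedge_left ext_linear_add[OF hr] ext_power_add_closed\<close>)
    then show "h (A \<bullet> (B \<oplus>\<^bsub>\<L>\<^esub> C)) = h (A \<bullet> B \<oplus>\<^bsub>\<L>\<^esub> A \<bullet> C)"
      using BC assms by (simp add: ext_linear_add[OF h] circ_closed)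
  qed (use assms BC in \<open>auto intro!: circ_closed ext_power_add_closed\<close>)
  have smult: "A \<bullet> (c \<odot>\<^bsub>\<L>\<^esub> B) = c \<odot>\<^bsub>\<L>\<^esub> A \<bullet> B" if B: "B \<in> carrier \<L>" for c B
  proof (rule ext_power_eqI)
    fix h assume h: "functional h"
    have "ext_linear scale (n - 1) (*) (\<lambda>A. c * h (A \<bullet> B))"
      using hl[OF B h] by (simp add: ext_linear_def algebra_simps)
    from ext_linear_eqI[OF hl[OF ext_power_smult_closed[OF B] h] this _ assms]
    have "h (A \<bullet> (c \<odot>\<^bsub>\<L>\<^esub> B)) = c * h (A \<bullet> B)"
      using B h by (auto simp: circ_wedge_left ext_linear_smult[OF hr] ext_power_smult_closed)
    then show "h (A \<bullet> (c \<odot>\<^bsub>\<L>\<^esub> B)) = h (c \<odot>\<^bsub>\<L>\<^esub> A \<bullet> B)"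
      using B assms by (simp add: ext_linear_smult[OF h] circ_closed)
  qed (use assms B in \<open>auto intro!: circ_closed ext_power_smult_closed\<close>)
  show ?thesis using add smult circ_closed assms by (auto simp: carrier_linear_def)
qed

lemma ext_linear_circ:
  assumes "ext_linear scale (n - 1) sw h" "length xs = n - 1" "length ys = n - 1"
  shows "h (wedge scale xs \<bullet> wedge scale ys) = der (ad xs) (\<lambda>ws. h (wedge scale ws)) ys"
  using assms by (simp add: circ_wedge_left wedge_in_ext_power circ_left_wedge
    ext_linear_circ_wedge[OF assms(1)])

lemma ext_linear_circ_left:
  "ext_linear scale (n - 1) sw h \<Longrightarrow> B \<in> carrier \<L> \<Longrightarrow> ext_linear scale (n - 1) sw (\<lambda>A. h (A \<bullet> B))"
  by (rule carrier_linear_ext_power_compose[OF circ_linear_left])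

lemma ext_linear_circ_right:
  "ext_linear scale (n - 1) sw h \<Longrightarrow> A \<in> carrier \<L> \<Longrightarrow> ext_linear scale (n - 1) sw (\<lambda>B. h (A \<bullet> B))"
  by (rule carrier_linear_ext_power_compose[OF circ_linear_right])

text \<open>
  With \<open>F\<close> the alternating form that belongs to the functional \<open>h\<close>, the two nested products
  give \<open>der (ad ys) (der (ad xs) F)\<close> and \<open>der (ad xs) (der (ad ys) F)\<close>, in the order opposite
  to that of the factors. The remaining term is the action of the commutator of \<open>ad xs\<close> and
  \<open>ad ys\<close> by the Filippov identity.
\<close>

lemma leibniz_wedge:
  assumes h: "functional h" and len: "length xs = n - 1" "length ys = n - 1" "length zs = n - 1"
  shows "h (wedge scale xs \<bullet> (wedge scale ys \<bullet> wedge scale zs))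
    = h ((wedge scale xs \<bullet> wedge scale ys) \<bullet> wedge scale zs)
      + h (wedge scale ys \<bullet> (wedge scale xs \<bullet> wedge scale zs))"
proof -
  let ?X = "wedge scale xs" and ?Y = "wedge scale ys" and ?Z = "wedge scale zs"
  define F where "F = (\<lambda>ws. h (wedge scale ws))"
  have F: "alternating_multilinear (n - 1) scale (*) F"
    unfolding F_def by (rule functional_wedge[OF h])
  have XYZ: "?X \<in> carrier \<L>" "?Y \<in> carrier \<L>" "?Z \<in> carrier \<L>"
    using len by (simp_all add: wedge_in_ext_power)
  have nested: "h (wedge scale us \<bullet> (wedge scale vs \<bullet> ?Z)) = der (ad vs) (der (ad us) F) zs"
    if "length us = n - 1" "length vs = n - 1" for us vs
  proof -
    have "h (wedge scale us \<bullet> (wedge scale vs \<bullet> ?Z))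
       = der (ad vs) (\<lambda>ws. h (wedge scale us \<bullet> wedge scale ws)) zs"
      using that len
      by (intro ext_linear_circ[OF ext_linear_circ_right[OF h]]) (auto simp: wedge_in_ext_power)
    also have "\<dots> = der (ad vs) (der (ad us) F) zs"
      unfolding F_def using that len by (intro der_cong) (simp add: ext_linear_circ[OF h])
    finally show ?thesis .
  qed
  have "h ((?X \<bullet> ?Y) \<bullet> ?Z)
      = der (ad xs) (\<lambda>ws. h (wedge scale ws \<bullet> ?Z)) ys"
    using len XYZ by (intro ext_linear_circ[OF ext_linear_circ_left[OF h]])
  also have "\<dots> = der (ad xs) (\<lambda>ws. der (ad ws) F zs) ys"
    unfolding F_def using len by (intro der_cong) (simp add: ext_linear_circ[OF h])
  also have "\<dots> = (\<Sum>i<length zs. der (ad xs) (\<lambda>ws. F (zs[i := ad ws (zs ! i)])) ys)"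
    unfolding der_sum[symmetric] by (simp only: der_def[of _ _ zs])
  also have "\<dots> = (\<Sum>i<length zs. F (zs[i := ad xs (ad ys (zs ! i)) - ad ys (ad xs (zs ! i))]))"
  proof (intro sum.cong refl)
    fix i assume "i \<in> {..<length zs}"
    then have "Vector_Spaces.linear scale (*) (\<lambda>x. F (zs[i := x]))"
      using alternating_multilinear_linear[OF F] len by auto
    from linear_der[OF this, of "ad xs" "\<lambda>ws. ad ws (zs ! i)" ys] len
    show "der (ad xs) (\<lambda>ws. F (zs[i := ad ws (zs ! i)])) ys
      = F (zs[i := ad xs (ad ys (zs ! i)) - ad ys (ad xs (zs ! i))])"
      by (simp add: ad_der)
  qed
  also have "\<dots> = der (\<lambda>z. ad xs (ad ys z) - ad ys (ad xs z)) F zs"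
    by (simp add: der_def)
  also have "\<dots> = der (ad ys) (der (ad xs) F) zs - der (ad xs) (der (ad ys) F) zs"
    using der_commutator[OF F len(3), of "ad ys" "ad xs"] by simp
  finally show ?thesis
    using nested[OF len(1,2)] nested[OF len(2,1)] by simp
qed

text \<open>
  Both sides of the Leibniz identity are linear in each of the three arguments, which are
  replaced by wedges one after the other.
\<close>

lemma leibniz_algebra_circ: "leibniz_algebra \<L> (circ scale n br)"
proof (intro leibniz_algebra.intro leibniz_algebra_axioms.intro module_ext_power)
  show "carrier_bilinear \<L> \<L> \<L> (circ scale n br)"
    by (simp add: carrier_bilinear_def circ_linear_left circ_linear_right)
  fix A B C assume ABC: "A \<in> carrier \<L>" "B \<in> carrier \<L>" "C \<in> carrier \<L>"
  show "A \<bullet> (B \<bullet> C) = (A \<bullet> B) \<bullet> C \<oplus>\<^bsub>\<L>\<^esub> B \<bullet> (A \<bullet> C)"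
  proof (rule ext_power_eqI)
    fix h assume h: "functional h"
    define l where "l = (\<lambda>A B C. h (A \<bullet> (B \<bullet> C)))"
    define r where "r = (\<lambda>A B C. h ((A \<bullet> B) \<bullet> C) + h (B \<bullet> (A \<bullet> C)))"
    have l1: "ext_linear scale (n - 1) (*) (\<lambda>A. l A B C)"
      if "A \<in> carrier \<L>" "B \<in> carrier \<L>" "C \<in> carrier \<L>" for A B C
      unfolding l_def
      by (rule ext_linear_circ_left[OF h circ_closed[OF that(2,3)]])
    have l2: "ext_linear scale (n - 1) (*) (\<lambda>B. l A B C)"
      if "A \<in> carrier \<L>" "B \<in> carrier \<L>" "C \<in> carrier \<L>" for A B C
      unfolding l_def
      by (rule ext_linear_circ_left[OF ext_linear_circ_right[OF h that(1)] that(3)])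
    have l3: "ext_linear scale (n - 1) (*) (\<lambda>C. l A B C)"
      if "A \<in> carrier \<L>" "B \<in> carrier \<L>" "C \<in> carrier \<L>" for A B C
      unfolding l_def
      by (rule ext_linear_circ_right[OF ext_linear_circ_right[OF h that(1)] that(2)])
    have r1: "ext_linear scale (n - 1) (*) (\<lambda>A. r A B C)"
      if "A \<in> carrier \<L>" "B \<in> carrier \<L>" "C \<in> carrier \<L>" for A B C
      unfolding r_def
      by (rule ext_linear_plus[OF vector_space_field
          ext_linear_circ_left[OF ext_linear_circ_left[OF h that(3)] that(2)]
          ext_linear_circ_left[OF ext_linear_circ_right[OF h that(2)] that(3)]])
    have r2: "ext_linear scale (n - 1) (*) (\<lambda>B. r A B C)"
      if "A \<in> carrier \<L>" "B \<in> carrier \<L>" "C \<in> carrier \<L>" for A B C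
      unfolding r_def
      by (rule ext_linear_plus[OF vector_space_field
          ext_linear_circ_right[OF ext_linear_circ_left[OF h that(3)] that(1)]
          ext_linear_circ_left[OF h circ_closed[OF that(1,3)]]])
    have r3: "ext_linear scale (n - 1) (*) (\<lambda>C. r A B C)"
      if "A \<in> carrier \<L>" "B \<in> carrier \<L>" "C \<in> carrier \<L>" for A B C
      unfolding r_def
      by (rule ext_linear_plus[OF vector_space_field
          ext_linear_circ_right[OF h circ_closed[OF that(1,2)]]
          ext_linear_circ_right[OF ext_linear_circ_right[OF h that(2)] that(1)]])
    have wedges: "l (wedge scale xs) (wedge scale ys) (wedge scale zs)
      = r (wedge scale xs) (wedge scale ys) (wedge scale zs)"
      if "length xs = n - 1" "length ys = n - 1" "length zs = n - 1" for xs ys zs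
      unfolding l_def r_def by (rule leibniz_wedge[OF h that])
    \<comment> \<open>The three arguments are now generalized from wedges, starting with the last.\<close>
    have wedges2: "l (wedge scale xs) (wedge scale ys) C = r (wedge scale xs) (wedge scale ys) C"
      if len: "length xs = n - 1" "length ys = n - 1" for xs ys
      using wedge_in_ext_power[OF len(1)] wedge_in_ext_power[OF len(2)] ABC(3)
      by (intro ext_linear_eqI[OF l3 r3 wedges]) (simp_all add: len)
    have wedges1: "l (wedge scale xs) B C = r (wedge scale xs) B C"
      if len: "length xs = n - 1" for xs
      using wedge_in_ext_power[OF len] ABC(2,3)
      by (intro ext_linear_eqI[OF l2 r2 wedges2]) (simp_all add: len)
    have "l A B C = r A B C"
      using ABC by (intro ext_linear_eqI[OF l1 r1 wedges1]) simp_all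
    then have "h (A \<bullet> (B \<bullet> C)) = h ((A \<bullet> B) \<bullet> C) + h (B \<bullet> (A \<bullet> C))"
      by (simp add: l_def r_def)
    then show "h (A \<bullet> (B \<bullet> C)) = h ((A \<bullet> B) \<bullet> C \<oplus>\<^bsub>\<L>\<^esub> B \<bullet> (A \<bullet> C))"
      using ABC by (simp add: ext_linear_add[OF h] circ_closed)
  qed (use ABC in \<open>auto intro!: circ_closed ext_power_add_closed\<close>)
qed

end


section \<open>Omitting an entry of a list\<close>

lemma length_omit: "i < length xs \<Longrightarrow> length (omit i xs) = length xs - 1"
  by (simp add: omit_def)

lemma nth_omit:
  "i < length xs \<Longrightarrow> j < length xs - 1 \<Longrightarrow> omit i xs ! j = xs ! (if j < i then j else Suc j)"
  by (simp add: omit_def nth_append)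

lemma omit_update_same: "omit i (xs[i := x]) = omit i xs"
  by (simp add: omit_def)

lemma omit_update_other:
  assumes "i < length xs" "j < length xs" "i \<noteq> j"
  shows "omit i (xs[j := x]) = (omit i xs)[(if j < i then j else j - 1) := x]"
  using assms
  by (intro nth_equalityI) (auto simp: length_omit nth_omit nth_list_update)

lemma omit_append: "i < length xs \<Longrightarrow> omit i (xs @ ys) = omit i xs @ ys"
  by (simp add: omit_def)

lemma omit_length: "omit (length us) (us @ a # vs) = us @ vs"
  by (simp add: omit_def)


section \<open>The actions on \<open>Hom(\<gg>, V)\<close>\<close>

locale n_Lie_hom_module = n_Lie_algebra sg n br + V: vector_space sv
  for sg :: "'k::field_char_0 \<Rightarrow> 'g::ab_group_add \<Rightarrow> 'g" and n br
    and sv :: "'k \<Rightarrow> 'v::ab_group_add \<Rightarrow> 'v" +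
  fixes \<rho> :: "('g list \<Rightarrow>\<^sub>0 'k) set \<Rightarrow> 'v \<Rightarrow> 'v"
  assumes \<rho>_linear: "carrier_linear (ext_power sg (n - 1)) (hom_space sv sv) \<rho>"
begin

abbreviation (input) act :: "'g list \<Rightarrow> 'v \<Rightarrow> 'v"
  where "act xs \<equiv> \<rho> (wedge sg xs)"

abbreviation (input) product' (infixl "\<bullet>" 75)
  where "A \<bullet> B \<equiv> circ sg n br A B"

abbreviation (input) sign :: "nat \<Rightarrow> 'k"
  where "sign i \<equiv> (-1) ^ (n - 1 - i)"

abbreviation (input) lact
  where "lact \<equiv> hom_lact sg br sv \<rho>"

abbreviation (input) ract
  where "ract \<equiv> hom_ract sg n br sv \<rho>"

abbreviation (input) \<H>
  where "\<H> \<equiv> hom_space sg sv"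

lemma \<rho>_ext_linear: "ext_linear sg (n - 1) sv (\<lambda>A. \<rho> A v)"
  by (rule carrier_linear_hom_space_apply[OF \<rho>_linear])

lemma act_linear: "length xs = n - 1 \<Longrightarrow> Vector_Spaces.linear sv sv (act xs)"
  using carrier_linear_closed[OF \<rho>_linear wedge_in_ext_power] by (simp add: hom_space_simps)

lemma act_alternating: "alternating_multilinear (n - 1) sg sv (\<lambda>xs. act xs v)"
  by (rule ext_linear_wedge[OF \<rho>_ext_linear vector_space_axioms V.vector_space_axioms])

lemma linear_linear_diff:
  assumes "Vector_Spaces.linear s1 sv f" "Vector_Spaces.linear s1 sv g"
  shows "Vector_Spaces.linear s1 sv (\<lambda>x. f x - g x)"
  using assms by (auto simp: Vector_Spaces.linear_iff V.scale_right_diff_distrib)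

definition act_sum :: "('g \<Rightarrow> 'v) \<Rightarrow> 'g list \<Rightarrow> 'v"
  where "act_sum \<phi> zs = (\<Sum>i<n. sv (sign i) (act (omit i zs) (\<phi> (zs ! i))))"

text \<open>
  The value of \<open>[\<phi>, (z\<^sub>1, \<dots>, z\<^sub>n\<^sub>-\<^sub>1)]\<^sub>R\<close> at \<open>z\<^sub>n\<close>, regarded as a function of all \<open>n\<close> entries.
  In this form the last entry plays the same part as the others; it is, up to sign, the
  formula for the coboundary of the \<open>1\<close>-cochain \<open>\<phi>\<close>.
\<close>

definition coboundary :: "('g \<Rightarrow> 'v) \<Rightarrow> 'g list \<Rightarrow> 'v"
  where "coboundary \<phi> zs = \<phi> (br zs) - act_sum \<phi> zs"

lemma act_sum_linear_entry:
  assumes \<phi>: "Vector_Spaces.linear sg sv \<phi>" and zs: "length zs = n" "j < n"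
  shows "Vector_Spaces.linear sg sv (\<lambda>x. act_sum \<phi> (zs[j := x]))"
  unfolding act_sum_def
proof (intro linear_sum_scaled vector_space_axioms V.vector_space_axioms)
  fix i assume "i \<in> {..<n}"
  then have i: "i < n" by simp
  have "Vector_Spaces.linear sg sv (\<lambda>x. act (omit i (zs[j := x])) (\<phi> (zs[j := x] ! i)))"
  proof (cases "i = j")
    case True
    have "length (omit i zs) = n - 1" using zs i by (simp add: length_omit)
    from Vector_Spaces.linear_compose[OF \<phi> act_linear[OF this]]
    show ?thesis using True zs by (simp add: omit_update_same o_def)
  next
    case False
    then show ?thesis
      using alternating_multilinear_linear[OF act_alternating, of "omit i zs"
        "if j < i then j else j - 1" "\<phi> (zs ! i)"]
        zs i by (auto simp: omit_update_other length_omit)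
  qed
  from Vector_Spaces.linear_compose[OF this linear_scale_right[OF V.vector_space_axioms]]
  show "Vector_Spaces.linear sg sv (\<lambda>x. sv (sign i) (act (omit i (zs[j := x])) (\<phi> (zs[j := x] ! i))))"
    by (simp add: o_def)
qed

text \<open>
  Only the positions \<open>i\<close> and \<open>j\<close> contribute, since all other lists retain both equal entries.
  The two lists that remain differ by moving one entry past the \<open>j - i - 1\<close> entries between
  them, while the signs in the sum differ by the factor \<open>(-1)\<^sup>j\<^sup>-\<^sup>i\<close>; hence the terms cancel.
\<close>

lemma act_sum_repeated_entry:
  assumes zs: "length zs = n" "i < j" "j < n" "zs ! i = zs ! j"
  shows "act_sum \<phi> zs = 0"
proof -
  have "sv (sign k) (act (omit k zs) (\<phi> (zs ! k))) = 0" if "k \<in> {..<n} - {i, j}" for k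
  proof -
    define i' j' where "i' = (if i < k then i else i - 1)" "j' = (if j < k then j else j - 1)"
    have "omit k zs ! i' = zs ! i" "omit k zs ! j' = zs ! j" "i' < n - 1" "j' < n - 1" "i' \<noteq> j'"
      using zs that by (auto simp: i'_j'_def nth_omit)
    with zs that alternating_multilinear_eq_0[OF act_alternating, of "omit k zs" i' j']
    show ?thesis by (simp add: length_omit)
  qed
  then have "act_sum \<phi> zs = (\<Sum>k\<in>{i, j}. sv (sign k) (act (omit k zs) (\<phi> (zs ! k))))"
    unfolding act_sum_def using zs by (intro sum.mono_neutral_right) auto
  also have "\<dots> = sv (sign i) (act (omit i zs) (\<phi> (zs ! i)))
    + sv (sign j) (act (omit j zs) (\<phi> (zs ! i)))"
    using zs by simp
  also have "\<dots> = 0"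
  proof -
    obtain us a vs ws where e: "zs = us @ a # vs @ a # ws" and us: "length us = i"
      "length vs = j - Suc i"
      by (rule split_at_repeated_entry[of i j zs]) (use zs that in \<open>simp_all only:\<close>)
    have oi: "omit i zs = us @ vs @ a # ws"
      using omit_length[of us a "vs @ a # ws"] us by (simp add: e)
    have oj: "omit j zs = us @ a # vs @ ws"
      using omit_length[of "us @ a # vs" a ws] us zs by (simp add: e)
    have "act (omit j zs) v = sv ((-1) ^ (j - Suc i)) (act (omit i zs) v)" for v
      unfolding oi oj us(2)[symmetric]
      by (rule alternating_multilinear_move[OF act_alternating]) (use zs(1) n_ge_2 in \<open>simp add: e\<close>)
    moreover have "sign i = - (sign j * (-1) ^ (j - Suc i))"
    proof -
      have "n - 1 - i = Suc ((n - 1 - j) + (j - Suc i))" using zs by linarith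
      then show ?thesis by (simp only: power_Suc power_add) simp
    qed
    ultimately show ?thesis by simp
  qed
  finally show ?thesis .
qed

text \<open>
  This yields at once that the right action is alternating in the element of \<open>\<L>\<close> and that its
  values are linear maps.
\<close>

lemma coboundary_alternating:
  assumes "Vector_Spaces.linear sg sv \<phi>"
  shows "alternating_multilinear n sg sv (coboundary \<phi>)"
proof -
  have "alternating_multilinear n sg sv (act_sum \<phi>)"
    using act_sum_linear_entry[OF assms] act_sum_repeated_entry
    by (auto simp: alternating_multilinear_def)
  from alternating_multilinear_diff[OF alternating_multilinear_compose[OF br_alternating assms]
    this V.vector_space_axioms]
  show ?thesis by (simp add: coboundary_def[abs_def])
qed

text \<open>
  The formulas whose linear extensions to \<open>\<L>\<close> are the two actions (\<open>lact_eq\<close> and \<open>ract_eq\<close>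
  below).
\<close>

definition lact_fun :: "'g list \<Rightarrow> ('g \<Rightarrow> 'v) \<Rightarrow> 'g \<Rightarrow> 'v"
  where "lact_fun xs \<phi> x = act xs (\<phi> x) - \<phi> (ad xs x)"

definition ract_fun :: "'g list \<Rightarrow> ('g \<Rightarrow> 'v) \<Rightarrow> 'g \<Rightarrow> 'v"
  where "ract_fun xs \<phi> x = coboundary \<phi> (xs @ [x])"

lemma lact_eq: "lact A \<phi> = extend \<H> (\<lambda>xs. lact_fun xs \<phi>) A"
  by (simp add: hom_lact_def lact_fun_def[abs_def])

lemma ract_eq: "ract \<phi> A = extend \<H> (\<lambda>xs. ract_fun xs \<phi>) A"
  by (simp add: hom_ract_def ract_fun_def[abs_def] coboundary_def act_sum_def Let_def)

context
  fixes \<phi> assumes \<phi>: "Vector_Spaces.linear sg sv \<phi>"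
begin

lemma lact_fun_linear:
  assumes "length xs = n - 1"
  shows "Vector_Spaces.linear sg sv (lact_fun xs \<phi>)"
  using linear_linear_diff[OF Vector_Spaces.linear_compose[OF \<phi> act_linear[OF assms]]
      Vector_Spaces.linear_compose[OF ad_linear[OF assms] \<phi>]]
  by (simp add: lact_fun_def[abs_def] o_def)

lemma lact_fun_alternating: "alternating_multilinear (n - 1) sg sv (\<lambda>xs. lact_fun xs \<phi> z)"
  using alternating_multilinear_diff[OF act_alternating
    alternating_multilinear_compose[OF ad_alternating \<phi>] V.vector_space_axioms]
  by (simp add: lact_fun_def)

lemma ract_fun_linear: "length xs = n - 1 \<Longrightarrow> Vector_Spaces.linear sg sv (ract_fun xs \<phi>)"
  using alternating_multilinear_linear_append[OF coboundary_alternating[OF \<phi>], of xs "[]"] n_ge_2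
  by (simp add: ract_fun_def[abs_def])

lemma ract_fun_alternating: "alternating_multilinear (n - 1) sg sv (\<lambda>xs. ract_fun xs \<phi> z)"
  using alternating_multilinear_butlast[OF coboundary_alternating[OF \<phi>]] n_ge_2
  by (simp add: ract_fun_def)

lemma lact_wedge: "length xs = n - 1 \<Longrightarrow> lact (wedge sg xs) \<phi> = lact_fun xs \<phi>"
  unfolding lact_eq
  by (rule hom_extend_wedge[OF vector_space_axioms V.vector_space_axioms lact_fun_linear
    lact_fun_alternating])

lemma lact_linear_left: "carrier_linear \<L> \<H> (\<lambda>A. lact A \<phi>)"
  unfolding lact_eq
  by (rule hom_extend_linear[OF vector_space_axioms V.vector_space_axioms lact_fun_linear
    lact_fun_alternating])

lemma ract_wedge: "length xs = n - 1 \<Longrightarrow> ract \<phi> (wedge sg xs) = ract_fun xs \<phi>"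
  unfolding ract_eq
  by (rule hom_extend_wedge[OF vector_space_axioms V.vector_space_axioms ract_fun_linear
    ract_fun_alternating])

lemma ract_linear_right: "carrier_linear \<L> \<H> (ract \<phi>)"
  unfolding ract_eq[abs_def]
  by (rule hom_extend_linear[OF vector_space_axioms V.vector_space_axioms ract_fun_linear
    ract_fun_alternating])

lemma lact_ext_linear: "ext_linear sg (n - 1) sv (\<lambda>A. lact A \<phi> z)"
  by (rule carrier_linear_hom_space_apply[OF lact_linear_left])

lemma ract_ext_linear: "ext_linear sg (n - 1) sv (\<lambda>A. ract \<phi> A z)"
  by (rule carrier_linear_hom_space_apply[OF ract_linear_right])

lemma lact_closed: "A \<in> carrier \<L> \<Longrightarrow> Vector_Spaces.linear sg sv (lact A \<phi>)"
  using carrier_linear_closed[OF lact_linear_left] by (simp add: hom_space_simps)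

lemma ract_closed: "A \<in> carrier \<L> \<Longrightarrow> Vector_Spaces.linear sg sv (ract \<phi> A)"
  using carrier_linear_closed[OF ract_linear_right] by (simp add: hom_space_simps)

end

lemma hom_add: "Vector_Spaces.linear sg sv \<phi> \<Longrightarrow> Vector_Spaces.linear sg sv \<psi>
  \<Longrightarrow> Vector_Spaces.linear sg sv (\<lambda>x. \<phi> x + \<psi> x)"
  by (auto simp: Vector_Spaces.linear_iff V.scale_right_distrib)

lemma hom_scale: "Vector_Spaces.linear sg sv \<phi> \<Longrightarrow> Vector_Spaces.linear sg sv (\<lambda>x. sv c (\<phi> x))"
  using Vector_Spaces.linear_compose[OF _ linear_scale_right[OF V.vector_space_axioms]]
  by (simp add: o_def)

lemma lact_fun_add: "length xs = n - 1
  \<Longrightarrow> lact_fun xs (\<lambda>x. \<phi> x + \<psi> x) z = lact_fun xs \<phi> z + lact_fun xs \<psi> z"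
  using act_linear[of xs] by (simp add: lact_fun_def Vector_Spaces.linear_iff)

lemma lact_fun_scale: "length xs = n - 1 \<Longrightarrow> lact_fun xs (\<lambda>x. sv c (\<phi> x)) z = sv c (lact_fun xs \<phi> z)"
  using act_linear[of xs] by (simp add: lact_fun_def Vector_Spaces.linear_iff
    V.scale_right_diff_distrib)

lemma coboundary_add:
  assumes "length zs = n"
  shows "coboundary (\<lambda>x. \<phi> x + \<psi> x) zs = coboundary \<phi> zs + coboundary \<psi> zs"
proof -
  have "act (omit i zs) (a + b) = act (omit i zs) a + act (omit i zs) b" if "i < n" for i a b
    using act_linear[of "omit i zs"] that assms by (simp add: length_omit Vector_Spaces.linear_iff)
  then show ?thesis by (simp add: coboundary_def act_sum_def V.scale_right_distrib sum.distrib)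
qed

lemma coboundary_scale:
  assumes "length zs = n"
  shows "coboundary (\<lambda>x. sv c (\<phi> x)) zs = sv c (coboundary \<phi> zs)"
proof -
  have "act (omit i zs) (sv c a) = sv c (act (omit i zs) a)" if "i < n" for i a
    using act_linear[of "omit i zs"] that assms by (simp add: length_omit Vector_Spaces.linear_iff)
  then show ?thesis
    by (simp add: coboundary_def act_sum_def V.scale_right_diff_distrib V.scale_sum_right
      mult.commute)
qed

lemma ract_fun_add: "length xs = n - 1
  \<Longrightarrow> ract_fun xs (\<lambda>x. \<phi> x + \<psi> x) z = ract_fun xs \<phi> z + ract_fun xs \<psi> z"
  using n_ge_2 by (simp add: ract_fun_def coboundary_add)

lemma ract_fun_scale: "length xs = n - 1 \<Longrightarrow> ract_fun xs (\<lambda>x. sv c (\<phi> x)) z = sv c (ract_fun xs \<phi> z)"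
  using n_ge_2 by (simp add: ract_fun_def coboundary_scale)

lemma ext_linear_scale:
  "ext_linear s k sv h \<Longrightarrow> ext_linear s k sv (\<lambda>A. sv c (h A))"
  by (simp add: ext_linear_def V.scale_right_distrib mult.commute)

lemma lact_linear_right:
  assumes A: "A \<in> carrier \<L>"
  shows "carrier_linear \<H> \<H> (lact A)"
proof -
  have "lact A (\<lambda>x. \<phi> x + \<psi> x) z = lact A \<phi> z + lact A \<psi> z"
    if "Vector_Spaces.linear sg sv \<phi>" "Vector_Spaces.linear sg sv \<psi>" for \<phi> \<psi> z
    by (rule ext_linear_eqI[OF lact_ext_linear[OF hom_add[OF that]]
          ext_linear_plus[OF V.vector_space_axioms lact_ext_linear[OF that(1)]
            lact_ext_linear[OF that(2)]] _ A])
      (use that in \<open>simp_all add: hom_add lact_wedge lact_fun_add\<close>)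
  moreover have "lact A (\<lambda>x. sv c (\<phi> x)) z = sv c (lact A \<phi> z)"
    if "Vector_Spaces.linear sg sv \<phi>" for c \<phi> z
    by (rule ext_linear_eqI[OF lact_ext_linear[OF hom_scale[OF that]]
          ext_linear_scale[OF lact_ext_linear[OF that]] _ A])
      (use that in \<open>simp_all add: hom_scale lact_wedge lact_fun_scale\<close>)
  ultimately show ?thesis
    using A by (auto simp: carrier_linear_def hom_space_simps lact_closed)
qed

lemma ract_linear_left:
  assumes A: "A \<in> carrier \<L>"
  shows "carrier_linear \<H> \<H> (\<lambda>\<phi>. ract \<phi> A)"
proof -
  have "ract (\<lambda>x. \<phi> x + \<psi> x) A z = ract \<phi> A z + ract \<psi> A z"
    if "Vector_Spaces.linear sg sv \<phi>" "Vector_Spaces.linear sg sv \<psi>" for \<phi> \<psi> z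
    by (rule ext_linear_eqI[OF ract_ext_linear[OF hom_add[OF that]]
          ext_linear_plus[OF V.vector_space_axioms ract_ext_linear[OF that(1)]
            ract_ext_linear[OF that(2)]] _ A])
      (use that in \<open>simp_all add: hom_add ract_wedge ract_fun_add\<close>)
  moreover have "ract (\<lambda>x. sv c (\<phi> x)) A z = sv c (ract \<phi> A z)"
    if "Vector_Spaces.linear sg sv \<phi>" for c \<phi> z
    by (rule ext_linear_eqI[OF ract_ext_linear[OF hom_scale[OF that]]
          ext_linear_scale[OF ract_ext_linear[OF that]] _ A])
      (use that in \<open>simp_all add: hom_scale ract_wedge ract_fun_scale\<close>)
  ultimately show ?thesis
    using A by (auto simp: carrier_linear_def hom_space_simps ract_closed)
qed


section \<open>Defects of the representation axioms\<close>

definition commutator_condition :: bool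
  where "commutator_condition \<longleftrightarrow> (\<forall>xs ys v. length xs = n - 1 \<longrightarrow> length ys = n - 1 \<longrightarrow>
    act xs (act ys v) - act ys (act xs v) = \<rho> (wedge sg xs \<bullet> wedge sg ys) v)"

text \<open>
  The condition (R2) is that this difference of its two sides vanishes. As a function it is
  needed because the axioms yield only a signed sum of its values.
\<close>

definition bracket_defect :: "'g list \<Rightarrow> 'g list \<Rightarrow> 'v \<Rightarrow> 'v"
  where "bracket_defect us zs v
    = act (us @ [br zs]) v - (\<Sum>i<n. sv (sign i) (act (omit i zs) (act (us @ [zs ! i]) v)))"

lemma \<rho>_circ:
  assumes "length xs = n - 1" "length ys = n - 1"
  shows "\<rho> (wedge sg xs \<bullet> wedge sg ys) v = der (ad xs) (\<lambda>ws. act ws v) ys"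
  by (rule ext_linear_circ[OF \<rho>_ext_linear assms])

text \<open>
  The terms that involve the bracket of \<open>\<gg>\<close> cancel by the Filippov identity. So (LLM) fails
  exactly as far as \<open>\<rho>\<close> fails to satisfy (R1).
\<close>

lemma LLM_defect:
  assumes \<phi>: "Vector_Spaces.linear sg sv \<phi>" and len: "length xs = n - 1" "length ys = n - 1"
  shows "lact (wedge sg xs \<bullet> wedge sg ys) \<phi> z
    - (lact_fun xs (lact_fun ys \<phi>) z - lact_fun ys (lact_fun xs \<phi>) z)
    = \<rho> (wedge sg xs \<bullet> wedge sg ys) (\<phi> z) - (act xs (act ys (\<phi> z)) - act ys (act xs (\<phi> z)))"
proof -
  have diff: "act us (a - b) = act us a - act us b" if "length us = n - 1" for us a b
    by (rule module_hom.diff[OF Vector_Spaces.linear.axioms(3)[OF act_linear[OF that]]])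
  have "lact (wedge sg xs \<bullet> wedge sg ys) \<phi> z = der (ad xs) (\<lambda>ws. lact (wedge sg ws) \<phi> z) ys"
    by (rule ext_linear_circ[OF lact_ext_linear[OF \<phi>] len])
  also have "\<dots> = der (ad xs) (\<lambda>ws. act ws (\<phi> z) - \<phi> (ad ws z)) ys"
    using len by (intro der_cong) (simp add: lact_wedge[OF \<phi>] lact_fun_def)
  also have "\<dots> = \<rho> (wedge sg xs \<bullet> wedge sg ys) (\<phi> z) - \<phi> (der (ad xs) (\<lambda>ws. ad ws z) ys)"
    by (simp add: der_diff \<rho>_circ[OF len] linear_der[OF \<phi>])
  also have "\<phi> (der (ad xs) (\<lambda>ws. ad ws z) ys) = \<phi> (ad xs (ad ys z)) - \<phi> (ad ys (ad xs z))"
    unfolding ad_der[OF len] by (rule module_hom.diff[OF Vector_Spaces.linear.axioms(3)[OF \<phi>]])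
  finally show ?thesis by (simp add: lact_fun_def diff len)
qed

text \<open>
  The coboundary commutes with the action of \<open>X = x\<^sub>1 \<and> \<dots> \<and> x\<^sub>n\<^sub>-\<^sub>1\<close> on cochains: for the term
  \<open>\<phi> [z\<^sub>1, \<dots>, z\<^sub>n]\<close> this is the Filippov identity, and for each summand of \<open>act_sum\<close> it is
  (R1) applied to \<open>X\<close> and the list that omits \<open>z\<^sub>i\<close>.
\<close>

lemma coboundary_lact_fun:
  assumes R1: commutator_condition and \<phi>: "Vector_Spaces.linear sg sv \<phi>" and len:
    "length xs = n - 1" "length zs = n"
  shows "coboundary (lact_fun xs \<phi>) zs = act xs (coboundary \<phi> zs) - der (ad xs) (coboundary \<phi>) zs"
proof -
  note act_hom = Vector_Spaces.linear.axioms(3)[OF act_linear]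
  have entry: "act (omit i zs) (lact_fun xs \<phi> (zs ! i))
      = act xs (act (omit i zs) (\<phi> (zs ! i))) - der (ad xs) (\<lambda>ws. act (omit i ws) (\<phi> (ws ! i)))
        zs" if "i < n" for i
  proof -
    have omit: "length (omit i zs) = n - 1" using that len by (simp add: length_omit)
    have "der (ad xs) (\<lambda>ws. act (omit i ws) (\<phi> (ws ! i))) zs
        = der (ad xs) (\<lambda>ws. act ws (\<phi> (zs ! i))) (omit i zs) + act (omit i zs) (\<phi> (ad xs (zs ! i)))"
      using der_omit[of i zs "ad xs" "\<lambda>ws a. act ws (\<phi> a)"] that len by simp
    moreover have "der (ad xs) (\<lambda>ws. act ws (\<phi> (zs ! i))) (omit i zs)
        = act xs (act (omit i zs) (\<phi> (zs ! i))) - act (omit i zs) (act xs (\<phi> (zs ! i)))"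
      using R1 len omit unfolding commutator_condition_def by (simp add: \<rho>_circ)
    ultimately show ?thesis
      by (simp add: lact_fun_def module_hom.diff[OF act_hom[OF omit]])
  qed
  have "der (ad xs) (coboundary \<phi>) zs = \<phi> (der (ad xs) br zs) - der (ad xs) (act_sum \<phi>) zs"
    by (simp add: coboundary_def[abs_def] der_diff linear_der[OF \<phi>])
  also have "der (ad xs) (act_sum \<phi>) zs
    = (\<Sum>i<n. sv (sign i) (der (ad xs) (\<lambda>ws. act (omit i ws) (\<phi> (ws ! i))) zs))"
    by (simp add: act_sum_def[abs_def] der_sum
      linear_der[OF linear_scale_right[OF V.vector_space_axioms]])
  finally have 1: "der (ad xs) (coboundary \<phi>) zs = \<phi> (ad xs (br zs))
      - (\<Sum>i<n. sv (sign i) (der (ad xs) (\<lambda>ws. act (omit i ws) (\<phi> (ws ! i))) zs))"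
    by (simp add: ad_br[OF len])
  have 2: "act xs (coboundary \<phi> zs) = act xs (\<phi> (br zs))
    - (\<Sum>i<n. sv (sign i) (act xs (act (omit i zs) (\<phi> (zs ! i)))))"
    by (simp add: coboundary_def act_sum_def module_hom.diff[OF act_hom[OF len(1)]]
      module_hom.sum[OF act_hom[OF len(1)]]
        module_hom.scale[OF act_hom[OF len(1)]])
  show ?thesis unfolding 1 2
    by (simp add: coboundary_def act_sum_def entry V.scale_right_diff_distrib sum_subtractf) (simp
      add: lact_fun_def)
qed

text \<open>
  This is the preceding commutation rule with the contribution of the last entry \<open>z\<close> written
  separately.
\<close>

lemma MLL_wedge:
  assumes R1: commutator_condition and \<phi>: "Vector_Spaces.linear sg sv \<phi>" and len:
    "length xs = n - 1" "length ys = n - 1"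
  shows "ract \<phi> (wedge sg xs \<bullet> wedge sg ys) z = lact_fun xs (ract_fun ys \<phi>) z
    - ract_fun ys (lact_fun xs \<phi>) z"
proof -
  have "ract \<phi> (wedge sg xs \<bullet> wedge sg ys) z = der (ad xs) (\<lambda>ws. ract \<phi> (wedge sg ws) z) ys"
    by (rule ext_linear_circ[OF ract_ext_linear[OF \<phi>] len])
  also have "\<dots> = der (ad xs) (\<lambda>ws. coboundary \<phi> (ws @ [z])) ys"
    using len by (intro der_cong) (simp add: ract_wedge[OF \<phi>] ract_fun_def)
  also have "\<dots> = der (ad xs) (coboundary \<phi>) (ys @ [z]) - coboundary \<phi> (ys @ [ad xs z])"
    by (simp add: der_append)
  also have "der (ad xs) (coboundary \<phi>) (ys @ [z]) = act xs (coboundary \<phi> (ys @ [z]))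
    - coboundary (lact_fun xs \<phi>) (ys @ [z])"
    using coboundary_lact_fun[OF R1 \<phi> len(1), of "ys @ [z]"] len(2) n_ge_2 by simp
  finally show ?thesis by (simp add: ract_fun_def lact_fun_def)
qed

text \<open>
  The bracket terms of the two actions cancel, and so do the terms \<open>\<rho>(x\<^sub>1, \<dots>, x\<^sub>n\<^sub>-\<^sub>1) \<phi>(z)\<close>;
  the latter is the summand of \<open>act_sum\<close> at the last position, whose sign is \<open>1\<close>.
\<close>

lemma ract_fun_plus_lact_fun:
  assumes "length xs = n - 1"
  shows "ract_fun xs \<phi> z + lact_fun xs \<phi> z =
    - (\<Sum>i<n - 1. sv (sign i) (act (omit i xs @ [z]) (\<phi> (xs ! i))))"
proof -
  have "act_sum \<phi> (xs @ [z]) = (\<Sum>i<Suc (n - 1). sv (sign i)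
    (act (omit i (xs @ [z])) (\<phi> ((xs @ [z]) ! i))))"
    using n_ge_2 by (simp add: act_sum_def)
  also have "\<dots> = (\<Sum>i<n - 1. sv (sign i) (act (omit i xs @ [z]) (\<phi> (xs ! i)))) + act xs (\<phi> z)"
  proof -
    have "omit (n - 1) (xs @ [z]) = xs" using omit_length[of xs z "[]"] assms by simp
    then show ?thesis using assms by (simp add: omit_append nth_append)
  qed
  finally show ?thesis by (simp add: ract_fun_def lact_fun_def coboundary_def)
qed

text \<open>
  Comparing (LML) with (MLL) shows that this expression has to vanish. Inserting the previous
  formula for the inner map and collecting, for each \<open>i\<close>, the terms that contain \<open>\<phi>(x\<^sub>i)\<close>
  gives the two sides of (R2).
\<close>

lemma ract_fun_ract_fun_plus_lact_fun:
  assumes len: "length xs = n - 1" "length ys = n - 1"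
  shows "ract_fun ys (\<lambda>x. ract_fun xs \<phi> x + lact_fun xs \<phi> x) z
    = - (\<Sum>i<n - 1. sv (sign i) (bracket_defect (omit i xs) (ys @ [z]) (\<phi> (xs ! i))))"
proof -
  define zs where "zs = ys @ [z]"
  have zs: "length zs = n" using len n_ge_2 by (simp add: zs_def)
  note act_hom = Vector_Spaces.linear.axioms(3)[OF act_linear]
  have omit: "length (omit j zs) = n - 1" if "j < n" for j using that zs by (simp add: length_omit)
  have "ract_fun ys (\<lambda>x. ract_fun xs \<phi> x + lact_fun xs \<phi> x) z
     = coboundary (\<lambda>x. - (\<Sum>i<n - 1. sv (sign i) (act (omit i xs @ [x]) (\<phi> (xs ! i))))) zs"
    by (simp add: ract_fun_def[of ys] zs_def ract_fun_plus_lact_fun[OF len(1)])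
  also have "\<dots> = - (\<Sum>i<n - 1. sv (sign i) (act (omit i xs @ [br zs]) (\<phi> (xs ! i))))
     + (\<Sum>j<n. \<Sum>i<n - 1. sv (sign j) (sv (sign i)
       (act (omit j zs) (act (omit i xs @ [zs ! j]) (\<phi> (xs ! i))))))"
    by (simp add: coboundary_def act_sum_def module_hom.neg[OF act_hom[OF omit]]
      module_hom.sum[OF act_hom[OF omit]]
        module_hom.scale[OF act_hom[OF omit]] V.scale_sum_right sum_negf)
  also have "(\<Sum>j<n. \<Sum>i<n - 1. sv (sign j)
    (sv (sign i) (act (omit j zs) (act (omit i xs @ [zs ! j]) (\<phi> (xs ! i))))))
     = (\<Sum>i<n - 1. sv (sign i) (\<Sum>j<n. sv (sign j)
       (act (omit j zs) (act (omit i xs @ [zs ! j]) (\<phi> (xs ! i))))))"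
    by (subst sum.swap) (simp add: V.scale_sum_right mult.commute)
  finally show ?thesis
    by (simp add: bracket_defect_def zs_def V.scale_right_diff_distrib sum_subtractf)
qed

context
  fixes \<phi> assumes \<phi>: "Vector_Spaces.linear sg sv \<phi>"
begin

lemma lact_lact_left: "B \<in> carrier \<L> \<Longrightarrow> ext_linear sg (n - 1) sv (\<lambda>A. lact A (lact B \<phi>) z)"
  by (rule lact_ext_linear[OF lact_closed[OF \<phi>]])

lemma lact_lact_right: "A \<in> carrier \<L> \<Longrightarrow> ext_linear sg (n - 1) sv (\<lambda>B. lact A (lact B \<phi>) z)"
  by (rule carrier_linear_hom_space_apply[OF
    carrier_linear_compose[OF lact_linear_left[OF \<phi>] lact_linear_right]])

lemma lact_ract_left: "B \<in> carrier \<L> \<Longrightarrow> ext_linear sg (n - 1) sv (\<lambda>A. lact A (ract \<phi> B) z)"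
  by (rule lact_ext_linear[OF ract_closed[OF \<phi>]])

lemma lact_ract_right: "A \<in> carrier \<L> \<Longrightarrow> ext_linear sg (n - 1) sv (\<lambda>B. lact A (ract \<phi> B) z)"
  by (rule carrier_linear_hom_space_apply[OF
    carrier_linear_compose[OF ract_linear_right[OF \<phi>] lact_linear_right]])

lemma ract_lact_left: "B \<in> carrier \<L> \<Longrightarrow> ext_linear sg (n - 1) sv (\<lambda>A. ract (lact A \<phi>) B z)"
  by (rule carrier_linear_hom_space_apply[OF
    carrier_linear_compose[OF lact_linear_left[OF \<phi>] ract_linear_left]])

lemma ract_lact_right: "A \<in> carrier \<L> \<Longrightarrow> ext_linear sg (n - 1) sv (\<lambda>B. ract (lact A \<phi>) B z)"
  by (rule ract_ext_linear[OF lact_closed[OF \<phi>]])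

lemma ract_ract_left: "B \<in> carrier \<L> \<Longrightarrow> ext_linear sg (n - 1) sv (\<lambda>A. ract (ract \<phi> A) B z)"
  by (rule carrier_linear_hom_space_apply[OF
    carrier_linear_compose[OF ract_linear_right[OF \<phi>] ract_linear_left]])

lemma ract_ract_right: "A \<in> carrier \<L> \<Longrightarrow> ext_linear sg (n - 1) sv (\<lambda>B. ract (ract \<phi> A) B z)"
  by (rule ract_ext_linear[OF ract_closed[OF \<phi>]])

end


section \<open>Equivalence of the axioms with the two conditions\<close>

lemma ext_linear_const_0: "ext_linear sg k sv (\<lambda>A. 0)"
  by (simp add: ext_linear_def)

lemma module_hom_g_V: "Module.module (K_ring :: 'k ring) \<H>"
  by (rule module_hom_space[OF vector_space_axioms V.vector_space_axioms])

text \<open>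
  The axioms are linear in both elements of \<open>\<L>\<close> and are checked on wedges. Given (MLL), the
  axiom (LML) is equivalent to \<open>[[\<phi>, A]\<^sub>R, B]\<^sub>R = - [[A, \<phi>]\<^sub>L, B]\<^sub>R\<close>, which is the form in
  which it is proved.
\<close>

lemma representation_if_conditions:
  assumes R1: commutator_condition and R2:
    "\<And>us zs v. length us = n - 2 \<Longrightarrow> length zs = n \<Longrightarrow> bracket_defect us zs v = 0"
  shows "leibniz_representation \<L> (circ sg n br) \<H> lact ract"
proof (intro leibniz_representation.intro leibniz_representation_axioms.intro leibniz_algebra_circ
  module_hom_g_V)
  show "carrier_bilinear \<L> \<H> \<H> lact"
    by (simp add: carrier_bilinear_def lact_linear_left lact_linear_right hom_space_simps)
  show "carrier_bilinear \<H> \<L> \<H> ract"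
    by (simp add: carrier_bilinear_def ract_linear_left ract_linear_right hom_space_simps)
  fix A B \<phi> assume AB: "A \<in> carrier \<L>" "B \<in> carrier \<L>" and "\<phi> \<in> carrier \<H>"
  then have \<phi>: "Vector_Spaces.linear sg sv \<phi>" by (simp add: hom_space_simps)
  note minus = hom_space_minus[OF vector_space_axioms V.vector_space_axioms]
  note circ_lin = ext_linear_circ_left[OF lact_ext_linear[OF \<phi>]] ext_linear_circ_right[OF
    lact_ext_linear[OF \<phi>]]
    ext_linear_circ_left[OF ract_ext_linear[OF \<phi>]] ext_linear_circ_right[OF ract_ext_linear[OF \<phi>]]
  have "lact (A \<bullet> B) \<phi> z = lact A (lact B \<phi>) z - lact B (lact A \<phi>) z" for z
  proof (rule ext_bilinear_eqI[where f = "\<lambda>A B. lact (A \<bullet> B) \<phi> z"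
        and g = "\<lambda>A B. lact A (lact B \<phi>) z - lact B (lact A \<phi>) z", OF circ_lin(1,2) _ _ _ AB])
    show "lact (wedge sg xs \<bullet> wedge sg ys) \<phi> z
        = lact (wedge sg xs) (lact (wedge sg ys) \<phi>) z - lact (wedge sg ys) (lact (wedge sg xs) \<phi>) z"
      if len: "length xs = n - 1" "length ys = n - 1" for xs ys
      using LLM_defect[OF \<phi> len, of z] R1 len unfolding commutator_condition_def
      by (simp add: lact_wedge \<phi> lact_fun_linear)
  qed (auto intro!: ext_linear_minus[OF V.vector_space_axioms] lact_lact_left[OF \<phi>]
    lact_lact_right[OF \<phi>])
  then show "lact (A \<bullet> B) \<phi> = lact A (lact B \<phi>) \<ominus>\<^bsub>\<H>\<^esub> lact B (lact A \<phi>)"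
    using AB by (simp add: minus lact_closed \<phi> fun_eq_iff)
  have MLL: "ract \<phi> (A \<bullet> B) z = lact A (ract \<phi> B) z - ract (lact A \<phi>) B z" for z
  proof (rule ext_bilinear_eqI[where f = "\<lambda>A B. ract \<phi> (A \<bullet> B) z"
        and g = "\<lambda>A B. lact A (ract \<phi> B) z - ract (lact A \<phi>) B z", OF circ_lin(3,4) _ _ _ AB])
    show "ract \<phi> (wedge sg xs \<bullet> wedge sg ys) z
        = lact (wedge sg xs) (ract \<phi> (wedge sg ys)) z - ract (lact (wedge sg xs) \<phi>) (wedge sg ys) z"
      if len: "length xs = n - 1" "length ys = n - 1" for xs ys
      using MLL_wedge[OF R1 \<phi> len, of z] len
      by (simp add: lact_wedge ract_wedge \<phi> lact_fun_linear ract_fun_linear)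
  qed (auto intro!: ext_linear_minus[OF V.vector_space_axioms] lact_ract_left[OF \<phi>]
    lact_ract_right[OF \<phi>]
      ract_lact_left[OF \<phi>] ract_lact_right[OF \<phi>])
  then show "ract \<phi> (A \<bullet> B) = lact A (ract \<phi> B) \<ominus>\<^bsub>\<H>\<^esub> ract (lact A \<phi>) B"
    using AB by (simp add: minus lact_closed ract_closed \<phi> fun_eq_iff)
  have "ract (ract \<phi> A) B z = - ract (lact A \<phi>) B z" for z
  proof -
    \<comment> \<open>On wedges the left-hand side is a combination of bracket defects.\<close>
    have "ract (ract \<phi> A) B z + ract (lact A \<phi>) B z = 0"
    proof (rule ext_bilinear_eqI[where f = "\<lambda>A B. ract (ract \<phi> A) B z + ract (lact A \<phi>) B z"
          and g = "\<lambda>A B. 0", OF _ _ _ _ _ AB])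
      show "ract (ract \<phi> (wedge sg xs)) (wedge sg ys) z
        + ract (lact (wedge sg xs) \<phi>) (wedge sg ys) z = 0"
        if len: "length xs = n - 1" "length ys = n - 1" for xs ys
      proof -
        have "ract_fun ys (\<lambda>x. ract_fun xs \<phi> x + lact_fun xs \<phi> x) z = 0"
          unfolding ract_fun_ract_fun_plus_lact_fun[OF len] using len n_ge_2
          by (simp add: R2 length_omit diff_diff_eq one_add_one)
        then show ?thesis
          using len by (simp add: ract_fun_add lact_wedge ract_wedge \<phi> lact_fun_linear
            ract_fun_linear)
      qed
    qed (auto intro!: ext_linear_plus[OF V.vector_space_axioms] ract_ract_left[OF \<phi>]
      ract_ract_right[OF \<phi>]
        ract_lact_left[OF \<phi>] ract_lact_right[OF \<phi>] ext_linear_const_0)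
    then show ?thesis by (simp add: eq_neg_iff_add_eq_0)
  qed
  with MLL show "ract \<phi> (A \<bullet> B) = ract (ract \<phi> A) B \<oplus>\<^bsub>\<H>\<^esub> lact A (ract \<phi> B)"
    by (simp add: hom_space_simps fun_eq_iff)
qed

text \<open>
  Linearity in the last entry reduces to the case that this entry occurs in \<open>us\<close>.
\<close>

lemma act_eq_0_if_in_span:
  assumes "length us = n - 2" "x \<in> span (set us)"
  shows "act (us @ [x]) v = 0"
  using assms(2)
proof (induction rule: span_induct)
  have lin: "Vector_Spaces.linear sg sv (\<lambda>x. act (us @ [x]) v)"
    using alternating_multilinear_linear_append[OF act_alternating, of us "[]"] assms(1) n_ge_2
    by simp
  case base
  show ?case
    by (rule subspaceI)
      (use lin module_hom.zero[OF Vector_Spaces.linear.axioms(3)[OF lin]] in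
        \<open>simp_all add: Vector_Spaces.linear_iff\<close>)
next
  case (step x)
  then show ?case
    using alternating_multilinear_not_distinct[OF act_alternating, of "us @ [x]" v] assms(1) n_ge_2
    by auto
qed

lemma act_eq_0_if_trivial:
  fixes xs :: "'g list"
  assumes "length xs = n - 1" "\<And>x :: 'g. x = 0"
  shows "act xs v = 0"
proof -
  have "Vector_Spaces.linear sg sv (\<lambda>x. act (xs[0 := x]) v)"
    using alternating_multilinear_linear[OF act_alternating, of xs 0] assms(1) n_ge_2 by simp
  from module_hom.zero[OF Vector_Spaces.linear.axioms(3)[OF this]]
  show ?thesis using assms(2)[of "xs ! 0"] by (metis list_update_id)
qed

text \<open>
  If \<open>\<gg> \<noteq> 0\<close>, every \<open>v\<close> is a value \<open>\<phi>(x)\<close>, so that (R1) can be read off from (LLM) at \<open>x\<close>. If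
  \<open>\<gg> = 0\<close>, then \<open>\<L> = 0\<close> because \<open>n - 1 \<ge> 1\<close>.
\<close>

lemma commutator_condition_if_representation:
  assumes rep: "leibniz_representation \<L> (circ sg n br) \<H> lact ract"
  shows commutator_condition
  unfolding commutator_condition_def
proof (intro allI impI)
  fix xs ys :: "'g list" and v assume len: "length xs = n - 1" "length ys = n - 1"
  show "act xs (act ys v) - act ys (act xs v) = \<rho> (wedge sg xs \<bullet> wedge sg ys) v"
  proof (cases "\<forall>x :: 'g. x = 0")
    case True
    then have "act ws u = 0" if "length ws = n - 1" for ws u
      using act_eq_0_if_trivial[OF that] by blast
    then show ?thesis using len by (simp add: \<rho>_circ der_def)
  next
    case False
    then obtain x :: 'g where "x \<noteq> 0" by blast
    then obtain \<phi> where \<phi>: "Vector_Spaces.linear sg sv \<phi>" "\<phi> x = v"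
      using exists_linear_vanishing_on_span[OF vector_space_axioms V.vector_space_axioms, of x
        "{}" v] by auto
    have "lact (wedge sg xs \<bullet> wedge sg ys) \<phi>
       = lact_fun xs (lact_fun ys \<phi>) \<ominus>\<^bsub>\<H>\<^esub> lact_fun ys (lact_fun xs \<phi>)"
      using leibniz_representation.LLM[OF rep, of "wedge sg xs" "wedge sg ys" \<phi>] len \<phi>(1)
      by (simp add: wedge_in_ext_power hom_space_simps lact_wedge lact_fun_linear)
    then have "lact (wedge sg xs \<bullet> wedge sg ys) \<phi> x
       = lact_fun xs (lact_fun ys \<phi>) x - lact_fun ys (lact_fun xs \<phi>) x"
      using len \<phi>(1) by (simp add: hom_space_minus[OF vector_space_axioms V.vector_space_axioms]
        lact_fun_linear)
    then show ?thesis using LLM_defect[OF \<phi>(1) len, of x] by (simp add: \<phi>(2))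
  qed
qed

text \<open>
  Complete \<open>us\<close> to \<open>xs\<close> by a vector \<open>x\<close> outside its span, and choose \<open>\<phi>\<close> to be \<open>v\<close> at \<open>x\<close> and
  \<open>0\<close> on the span. Then the sum of bracket defects that the representation axioms force to
  vanish consists of the wanted summand alone, up to sign, as all others contain a value of
  \<open>\<phi>\<close> on the span. If no such \<open>x\<close> exists, every wedge of \<open>us\<close> with one further vector is \<open>0\<close>,
  and both sides of (R2) vanish.
\<close>

lemma bracket_defect_eq_0_if_representation:
  assumes rep: "leibniz_representation \<L> (circ sg n br) \<H> lact ract"
    and len: "length us = n - 2" "length zs = n"
  shows "bracket_defect us zs v = 0"
proof (cases "\<exists>x. x \<notin> span (set us)")
  case False
  then have 0: "act (us @ [x]) w = 0" for x w using act_eq_0_if_in_span[OF len(1)] by blast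
  have "act (omit i zs) 0 = 0" if "i < n" for i
    using module_hom.zero[OF Vector_Spaces.linear.axioms(3)[OF act_linear[of "omit i zs"]]] that len
    by (simp add: length_omit)
  with 0 show ?thesis by (simp add: bracket_defect_def)
next
  case True
  then obtain x where "x \<notin> span (set us)" by blast
  from exists_linear_vanishing_on_span[OF vector_space_axioms V.vector_space_axioms this, of v]
  obtain \<phi> where \<phi>: "Vector_Spaces.linear sg sv \<phi>" "\<phi> x = v" "\<And>y. y \<in> span (set us) \<Longrightarrow> \<phi> y = 0"
    by blast
  define xs where "xs = us @ [x]"
  have xs: "length xs = n - 1" using len n_ge_2 by (simp add: xs_def)
  obtain ys z where ys: "zs = ys @ [z]" "length ys = n - 1"
    using len n_ge_2 by (cases zs rule: rev_cases) auto
  let ?X = "wedge sg xs" and ?Y = "wedge sg ys"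
  have XY: "?X \<in> carrier \<L>" "?Y \<in> carrier \<L>" using xs ys by (simp_all add: wedge_in_ext_power)
  have "ract (ract \<phi> ?X) ?Y \<oplus>\<^bsub>\<H>\<^esub> lact ?X (ract \<phi> ?Y) = lact ?X (ract \<phi> ?Y) \<ominus>\<^bsub>\<H>\<^esub> ract (lact ?X \<phi>) ?Y"
    using leibniz_representation.LML[OF rep XY, of \<phi>] leibniz_representation.MLL[OF rep XY, of \<phi>] \<phi>(1)
    by (simp add: hom_space_simps)
  also have "\<dots> = (\<lambda>w. lact ?X (ract \<phi> ?Y) w - ract (lact ?X \<phi>) ?Y w)"
    using XY \<phi>(1) by (intro hom_space_minus[OF vector_space_axioms V.vector_space_axioms])
      (simp_all add: lact_closed ract_closed)
  finally have "ract (ract \<phi> ?X) ?Y z + ract (lact ?X \<phi>) ?Y z = 0"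
    by (simp add: hom_space_simps fun_eq_iff algebra_simps)
  then have "ract_fun ys (\<lambda>x. ract_fun xs \<phi> x + lact_fun xs \<phi> x) z = 0"
    using xs ys \<phi>(1) by (simp add: ract_fun_add lact_wedge ract_wedge lact_fun_linear ract_fun_linear)
  then have "(\<Sum>i<n - 1. sv (sign i) (bracket_defect (omit i xs) zs (\<phi> (xs ! i)))) = 0"
    unfolding ract_fun_ract_fun_plus_lact_fun[OF xs ys(2)] by (simp add: ys(1))
  moreover have "n - 1 = Suc (n - 2)" using n_ge_2 by linarith
  ultimately have sum: "(\<Sum>i<Suc (n - 2). sv (sign i) (bracket_defect (omit i xs) zs (\<phi> (xs ! i))))
    = 0"
    by metis
  have "bracket_defect ws zs 0 = 0" if "length ws = n - 2" for ws
  proof -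
    have "act ws 0 = 0" if "length ws = n - 1" for ws
      by (rule module_hom.zero[OF Vector_Spaces.linear.axioms(3)[OF act_linear[OF that]]])
    then show ?thesis using that len n_ge_2 by (simp add: bracket_defect_def length_omit)
  qed
  moreover have "\<phi> (xs ! i) = 0" if "i < n - 2" for i
    using \<phi>(3)[OF span_base] that len by (simp add: xs_def nth_append)
  ultimately have "bracket_defect (omit i xs) zs (\<phi> (xs ! i)) = 0" if "i < n - 2" for i
    using that xs by (simp add: length_omit)
  then have "sv (sign (n - 2)) (bracket_defect (omit (n - 2) xs) zs (\<phi> (xs ! (n - 2)))) = 0"
    using sum by simp
  then show ?thesis
    using omit_length[of us x "[]"] len by (simp add: xs_def nth_append \<phi>(2))
qed

end

theorem theorem2p2:
  fixes sg :: "'k::field_char_0 \<Rightarrow> 'g::ab_group_add \<Rightarrow> 'g"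
    and n :: nat
    and br :: "'g list \<Rightarrow> 'g"
    and sv :: "'k \<Rightarrow> 'v::ab_group_add \<Rightarrow> 'v"
    and \<rho> :: "('g list \<Rightarrow>\<^sub>0 'k) set \<Rightarrow> 'v \<Rightarrow> 'v"
  assumes "n_Lie_algebra sg n br"
    and "vector_space sv"
    and "carrier_linear (ext_power sg (n - 1)) (hom_space sv sv) \<rho>"
  shows
    "leibniz_representation (ext_power sg (n - 1)) (circ sg n br)
       (hom_space sg sv) (hom_lact sg br sv \<rho>) (hom_ract sg n br sv \<rho>)
     \<longleftrightarrow>
     (\<forall>xs ys v. length xs = n - 1 \<longrightarrow> length ys = n - 1 \<longrightarrow>
        \<rho> (wedge sg xs) (\<rho> (wedge sg ys) v) - \<rho> (wedge sg ys) (\<rho> (wedge sg xs) v)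
          = \<rho> (circ sg n br (wedge sg xs) (wedge sg ys)) v) \<and>
     (\<forall>xs ys v. length xs = n - 2 \<longrightarrow> length ys = n \<longrightarrow>
        \<rho> (wedge sg (xs @ [br ys])) v
          = (\<Sum>i<n. sv ((-1) ^ (n - 1 - i))
               (\<rho> (wedge sg (omit i ys)) (\<rho> (wedge sg (xs @ [ys ! i])) v))))"
proof -
  interpret n_Lie_hom_module sg n br sv \<rho>
    using assms by (simp add: n_Lie_hom_module_def n_Lie_hom_module_axioms_def)
  show ?thesis
    using representation_if_conditions commutator_condition_if_representation
      bracket_defect_eq_0_if_representation
    unfolding commutator_condition_def bracket_defect_def right_minus_eq by blast
qed

end
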